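(* Let $r\in[1,\infty)$, $\theta\in[0,\infty)$, $\mathcal J=\mathcal F_c(\mathbb R^p)$, $\mathcal H_1\subseteq L^1[\mathcal F_c(\mathbb R^p)]$ and $\mathcal H_r\subseteq L^r[\mathcal F_c(\mathbb R^p)]$. Let $(D,\mathcal H)$ be either $(D_r^\theta,\mathcal H_1)$ or $(RD_r^\theta,\mathcal H_r)$. Then for every $\mathcal X\in\mathcal H$ and every $A\in\mathcal F_c(\mathbb R^p)$ with $D(A;\mathcal X)=\sup_{B\in\mathcal F_c(\mathbb R^p)}D(B;\mathcal X)$: (P3a) $D(A;\mathcal X)\ge D((1-\lambda)\cdot A+\lambda\cdot U;\mathcal X)\ge D(U;\mathcal X)$ for all $\lambda\in[0,1]$ and all $U\in\mathcal F_c(\mathbb R^p)$. (P4a) If $\theta\in(0,\infty)$, then $\lim_{\lambda\to\infty}D(A+\lambda\cdot U;\mathcal X)=0$ for all $U\in\mathcal F_c(\mathbb R^p)\setminus\{\mathrm I_{\{0\}}\}$. (P3b) If $\theta\in(0,\infty)$, then for each metric $d\in\{\rho_s,d_{s,\theta}\}$ with any $s\in(1,\infty)$: $D(A;\mathcal X)\ge D(U;\mathcal X)\ge D(V;\mathcal X)$ for all $U,V\in\mathcal F_c(\mathbb R^p)$ satisfying $d(A,V)=d(A,U)+d(U,V)$. (P4b) If $\theta\in(0,\infty)$, then for each metric $d\in\{\rho_s,d_{s,\theta}\}$ with any $s\in[1,r]$: $\lim_{n\to\infty}D(A_n;\mathcal X)=0$ for every sequence $\{A_n\}_n$ in $\mathcal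 F_c(\mathbb R^p)$ with $d(A_n,A)\to\infty$.
   Context: Fix an integer $p\ge1$; $\mathbb S^{p-1}=\{u\in\mathbb R^p:\|u\|=1\}$ with $\|\cdot\|$ the Euclidean norm. For $A:\mathbb R^p\to[0,1]$ the $\alpha$-levels are $A_\alpha=\{x:A(x)\ge\alpha\}$ for $\alpha\in(0,1]$, and $A_0$ is the closure of $\{x:A(x)>0\}$. $\mathcal F_c(\mathbb R^p)$ is the set of all $A:\mathbb R^p\to[0,1]$ such that $A_\alpha$ is non-empty, compact and convex for each $\alpha\in[0,1]$. $\mathcal K_c(\mathbb R^p)$ is the class of non-empty compact convex subsets of $\mathbb R^p$; $\|K\|=\max_{x\in K}\|x\|$ for $K\in\mathcal K_c(\mathbb R^p)$; $\mathrm I_K$ is the indicator function of $K$. Operations: $(A+B)(t)=\sup_{x+y=t}\min\{A(x),B(y)\}$ and $(\gamma\cdot A)(t)=\sup\{A(x):\gamma x=t\}$ for $\gamma\in\mathbb R$ (so $0\cdot A=\mathrm I_{\{0\}}$). The support function of $A$ is $s_A(u,\alpha)=\sup_{v\in A_\alpha}\langle u,v\rangle$, $(u,\alpha)\in\mathbb S^{p-1}\times[0,1]$; its mid and spread are $\mathrm{mid}(s_A)(u,\alpha)=(s_A(u,\alpha)-s_A(-u,\alpha))/2$ and $\mathrm{spr}(s_A)(u,\alpha)=(s_A(u,\alpha)+s_A(-u,\alpha))/2$. With $\mathcal V_p$ the normalized Haar (uniform probability) measure on $\mathbb S^{p-1}$, $\nu$ the Lebesgue measure on $[0,1]$ and $\|\cdot\|_r$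 the norm of $L^r(\mathbb S^{p-1}\times[0,1],\mathcal V_p\otimes\nu)$, set for $r\in[1,\infty)$: $\rho_r(A,B)=\|s_A-s_B\|_r$ and, for $\theta\ge0$, $d_{r,\theta}(A,B)=\left[\|\mathrm{mid}(s_A)-\mathrm{mid}(s_B)\|_r^r+\theta\|\mathrm{spr}(s_A)-\mathrm{spr}(s_B)\|_r^r\right]^{1/r}$ (a metric for $\theta>0$, a pseudometric for $\theta=0$). Given a probability space $(\Omega,\mathcal A,\mathbb P)$, a map $\mathcal X:\Omega\to\mathcal F_c(\mathbb R^p)$ is a fuzzy random variable if for every $\alpha\in[0,1]$ the map $\omega\mapsto\mathcal X_\alpha(\omega)=\mathcal X(\omega)_\alpha\in\mathcal K_c(\mathbb R^p)$ is Borel measurable with respect to the Hausdorff metric. For $r\in[1,\infty)$, $L^r[\mathcal F_c(\mathbb R^p)]$ is the class of fuzzy random variables with $\mathrm E[\|\mathcal X_0\|^r]<\infty$. The $(r,\theta)$-location depth is $D_r^\theta(A;\mathcal X)=(1+\mathrm E[d_{r,\theta}(A,\mathcal X)])^{-1}$ (defined by this formula for all $\mathcal X\in L^1[\mathcal F_c(\mathbb R^p)]$) and the $(r,\theta)$-location raised depth is $RD_r^\theta(A;\mathcal X)=(1+\mathrm E[d_{r,\theta}(A,\mathcal X)^r])^{-1}$. *)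

theory Defs
  imports "HOL-Probability.Probability"
begin

section \<open>Fuzzy sets\<close>

type_synonym 'p fuzzy = "real ^ 'p \<Rightarrow> real"

definition level :: "'p::finite fuzzy \<Rightarrow> real \<Rightarrow> (real ^ 'p) set" where
  "level A \<alpha> = (if \<alpha> = 0 then closure {x. A x > 0} else {x. A x \<ge> \<alpha>})"

definition Kc :: "(real ^ 'p::finite) set set" where
  "Kc = {K. K \<noteq> {} \<and> compact K \<and> convex K}"

definition Fc :: "'p::finite fuzzy set" where
  "Fc = {A. (\<forall>x. A x \<in> {0..1}) \<and> (\<forall>\<alpha>\<in>{0..1}. level A \<alpha> \<in> Kc)}"

definition crisp_zero :: "'p::finite fuzzy" where
  "crisp_zero = indicator {0}"

definition fuzzy_add :: "'p::finite fuzzy \<Rightarrow> 'p fuzzy \<Rightarrow> 'p fuzzy" where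
  "fuzzy_add A B = (\<lambda>t. Sup {min (A x) (B y) | x y. x + y = t})"

text \<open>The supremum is taken in \<open>[0,1]\<close>, where the supremum of the empty set is \<open>0\<close>. On the type of
  reals \<open>Sup {}\<close> is unspecified, so \<open>0\<close> is inserted explicitly. This changes nothing otherwise, as
  membership values are non-negative.\<close>

definition fuzzy_scale :: "real \<Rightarrow> 'p::finite fuzzy \<Rightarrow> 'p fuzzy" where
  "fuzzy_scale \<gamma> A = (\<lambda>t. Sup (insert 0 {A x | x. \<gamma> *\<^sub>R x = t}))"

lemma fuzzy_scale_zero:
  fixes A :: "'p::finite fuzzy"
  assumes "A \<in> Fc"
  shows "fuzzy_scale 0 A = crisp_zero"
proof
  fix t :: "real ^ 'p"
  have range: "0 \<le> A x" "A x \<le> 1" for x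
    using assms by (auto simp: Fc_def)
  have "level A 1 \<in> Kc"
    using assms by (auto simp: Fc_def)
  then obtain z where "A z \<ge> 1"
    by (auto simp: Kc_def level_def)
  with range[of z] have z: "A z = 1" by simp
  show "fuzzy_scale 0 A t = crisp_zero t"
  proof (cases "t = 0")
    case True
    have "Sup (insert 0 {A x | x. 0 *\<^sub>R x = t}) = 1"
      by (rule cSup_eq_maximum) (use True z range in \<open>auto intro: exI[of _ z]\<close>)
    then show ?thesis
      using True by (simp add: fuzzy_scale_def crisp_zero_def)
  next
    case False
    then show ?thesis
      by (simp add: fuzzy_scale_def crisp_zero_def)
  qed
qed

section \<open>The uniform distribution on the unit sphere\<close>

text \<open>The cone measure: the radial projection of the uniform distribution on the unit ball. It is the
  rotation invariant probability measure on the sphere, see the lemmas below. For \<open>CARD('p) = 1\<close> it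
  assigns mass \<open>1/2\<close> to each of the two points. The origin is removed so that the projection maps into
  the sphere.\<close>

definition sphere_measure :: "(real ^ 'p::finite) measure" where
  "sphere_measure =
     distr (restrict_space (uniform_measure lborel (ball 0 1)) (ball 0 1 - {0}))
       (restrict_space borel (sphere 0 1)) sgn"

lemma space_sphere_measure: "space sphere_measure = sphere 0 1"
  by (simp add: sphere_measure_def space_restrict_space)

lemma sets_sphere_measure: "sets sphere_measure = sets (restrict_space borel (sphere 0 1))"
  by (simp add: sphere_measure_def)

lemma sgn_measurable_sphere:
  "(sgn :: real ^ 'p::finite \<Rightarrow> _) \<in>
     restrict_space (uniform_measure lborel (ball 0 1)) (ball 0 1 - {0}) \<rightarrow>\<^sub>M
     restrict_space borel (sphere 0 1)"
proof (rule measurable_restrict_space2)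
  show "(sgn :: real ^ 'p \<Rightarrow> _) \<in> space (restrict_space (uniform_measure lborel (ball 0 1)) (ball 0 1 - {0})) \<rightarrow> sphere 0 1"
    by (auto simp: space_restrict_space norm_sgn)
  have "(\<lambda>x. x /\<^sub>R norm x :: real ^ 'p) \<in> uniform_measure lborel (ball 0 1) \<rightarrow>\<^sub>M borel"
    by (subst measurable_cong_sets[of _ lborel _ borel]) auto
  then show "(sgn :: real ^ 'p \<Rightarrow> _) \<in> restrict_space (uniform_measure lborel (ball 0 1)) (ball 0 1 - {0}) \<rightarrow>\<^sub>M borel"
    unfolding sgn_div_norm[abs_def] by (rule measurable_restrict_space1)
qed

lemma emeasure_unit_ball_finite:
  "emeasure lborel (ball 0 1 :: (real ^ 'p::finite) set) \<noteq> \<infinity>"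
  "emeasure lborel (ball 0 1 :: (real ^ 'p::finite) set) \<noteq> 0"
proof -
  show "emeasure lborel (ball 0 1 :: (real ^ 'p) set) \<noteq> \<infinity>"
    using emeasure_lborel_ball_finite[of "0 :: real ^ 'p" 1] by simp
  show "emeasure lborel (ball 0 1 :: (real ^ 'p) set) \<noteq> 0"
  proof
    assume "emeasure lborel (ball 0 1 :: (real ^ 'p) set) = 0"
    then have "ball 0 1 \<in> null_sets (lborel :: (real ^ 'p) measure)"
      by auto
    then have "(ball 0 1 :: (real ^ 'p) set) \<in> null_sets lebesgue"
      using null_sets_completion_iff2 by blast
    then have "negligible (ball 0 1 :: (real ^ 'p) set)"
      by (simp add: negligible_iff_null_sets)
    then show False
      using open_not_negligible[of "ball 0 1 :: (real ^ 'p) set"] by simp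
  qed
qed

lemma emeasure_sphere_measure:
  fixes S :: "(real ^ 'p::finite) set"
  assumes "S \<in> sets sphere_measure"
  shows "emeasure sphere_measure S =
    emeasure lborel {x \<in> ball 0 1 - {0}. sgn x \<in> S} / emeasure lborel (ball 0 1 :: (real ^ 'p) set)"
proof -
  let ?U = "uniform_measure lborel (ball 0 1 :: (real ^ 'p) set)"
  let ?C = "{x \<in> ball 0 1 - {0}. sgn x \<in> S}"
  have S: "S \<in> sets (restrict_space borel (sphere 0 1))"
    using assms by (simp add: sets_sphere_measure)
  have eq: "sgn -` S \<inter> space (restrict_space ?U (ball 0 1 - {0})) = ?C"
    by (auto simp: space_restrict_space)
  have "?C \<in> sets (restrict_space ?U (ball 0 1 - {0}))"
    using measurable_sets[OF sgn_measurable_sphere S] unfolding eq .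
  then have C: "?C \<in> sets lborel"
    by (subst (asm) sets_restrict_space_iff) auto
  have "emeasure sphere_measure S = emeasure (restrict_space ?U (ball 0 1 - {0})) ?C"
    unfolding sphere_measure_def by (subst emeasure_distr[OF sgn_measurable_sphere S]) (simp only: eq)
  also have "\<dots> = emeasure ?U ?C"
    by (rule emeasure_restrict_space) auto
  also have "\<dots> = emeasure lborel (ball 0 1 \<inter> ?C) / emeasure lborel (ball 0 1 :: (real ^ 'p) set)"
    using C by (intro emeasure_uniform_measure) auto
  also have "ball 0 1 \<inter> ?C = ?C" by auto
  finally show ?thesis .
qed

lemma prob_space_sphere_measure: "prob_space (sphere_measure :: (real ^ 'p::finite) measure)"
proof
  let ?B = "ball 0 1 :: (real ^ 'p) set"
  have "emeasure (sphere_measure :: (real ^ 'p) measure) (sphere 0 1) =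
      emeasure lborel {x \<in> ?B - {0}. sgn x \<in> sphere 0 1} / emeasure lborel ?B"
    by (rule emeasure_sphere_measure) (metis space_sphere_measure sets.top)
  also have "{x \<in> ?B - {0}. sgn x \<in> sphere 0 1} = ?B - {0}"
    by (auto simp: norm_sgn)
  also have "emeasure lborel (?B - {0}) = emeasure lborel ?B"
    by (rule emeasure_Diff_null_set) (auto simp: null_setsI)
  also have "emeasure lborel ?B / emeasure lborel ?B = 1"
    using emeasure_unit_ball_finite[where 'p='p]
    by (metis ennreal_divide_self infinity_ennreal_def less_top not_gr_zero zero_less_iff_neq_zero)
  finally show "emeasure (sphere_measure :: (real ^ 'p) measure) (space sphere_measure) = 1"
    by (simp add: space_sphere_measure)
qed

lemma nn_integral_lborel_shift:
  fixes h :: "'a::euclidean_space \<Rightarrow> ennreal"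
  assumes "h \<in> borel_measurable borel"
  shows "(\<integral>\<^sup>+x. h (x + c) \<partial>lborel) = (\<integral>\<^sup>+x. h x \<partial>lborel)"
proof -
  have "(\<integral>\<^sup>+x. h x \<partial>lborel) = (\<integral>\<^sup>+x. h x \<partial>distr lborel borel ((+) c))"
    by (simp only: lborel_distr_plus)
  also have "\<dots> = (\<integral>\<^sup>+x. h (x + c) \<partial>lborel)"
    using assms by (subst nn_integral_distr) (auto simp: add.commute)
  finally show ?thesis by simp
qed

lemma emeasure_lborel_orthogonal_vimage:
  fixes f :: "real ^ 'p::finite \<Rightarrow> real ^ 'p"
  assumes f: "orthogonal_transformation f" and E: "E \<in> sets borel"
  shows "emeasure lborel (f -` E) = emeasure lborel E"
proof -
  let ?B = "ball 0 1 :: (real ^ 'p) set"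
  have lin: "linear f" and nf: "norm (f x) = norm x" for x
    using f by (auto simp: orthogonal_transformation_linear orthogonal_transformation_norm)
  have fb [measurable]: "f \<in> borel \<rightarrow>\<^sub>M borel"
    using lin by (intro borel_measurable_continuous_onI linear_continuous_on)
      (simp add: linear_conv_bounded_linear)
  have fl [measurable]: "f \<in> lborel \<rightarrow>\<^sub>M borel"
    using fb by simp
  note E [measurable]
  have indE: "indicator E \<in> borel_measurable borel" and indB: "indicator ?B \<in> borel_measurable borel"
    using E by (auto intro!: borel_measurable_indicator)
  have m1: "(\<lambda>(x, y). indicator E (f x + y) * indicator ?B y :: ennreal)
      \<in> borel_measurable (lborel \<Otimes>\<^sub>M lborel)"
    unfolding case_prod_beta
    by (intro borel_measurable_times_ennreal measurable_compose[OF _ indE] measurable_compose[OF _ indB]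
        borel_measurable_add measurable_compose[OF _ fb]) measurable
  have m2: "(\<lambda>(x, y). indicator E y * indicator ?B (y - f x) :: ennreal)
      \<in> borel_measurable (lborel \<Otimes>\<^sub>M lborel)"
    unfolding case_prod_beta
    by (intro borel_measurable_times_ennreal measurable_compose[OF _ indE] measurable_compose[OF _ indB]
        borel_measurable_diff measurable_compose[OF _ fb]) measurable
  define g where "g = inv f"
  have g: "f (g y) = y" for y
    unfolding g_def by (rule surj_f_inv_f[OF orthogonal_transformation_surj[OF f]])
  have "emeasure lborel (f -` E) * emeasure lborel ?B =
      (\<integral>\<^sup>+y. emeasure lborel (f -` E) * indicator ?B y \<partial>lborel)"
    by (simp add: nn_integral_cmult_indicator)
  also have "\<dots> = (\<integral>\<^sup>+y. (\<integral>\<^sup>+x. indicator E (f x + y) * indicator ?B y \<partial>lborel) \<partial>lborel)"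
  proof (rule nn_integral_cong)
    fix y :: "real ^ 'p"
    have "(\<integral>\<^sup>+x. indicator E (f x + y) \<partial>lborel) = (\<integral>\<^sup>+x. indicator E (f (x + g y)) \<partial>lborel)"
      by (simp add: linear_add[OF lin] g)
    also have "\<dots> = (\<integral>\<^sup>+x. indicator E (f x) \<partial>lborel)"
      by (rule nn_integral_lborel_shift) simp
    also have "\<dots> = (\<integral>\<^sup>+x. indicator (f -` E) x \<partial>lborel)"
      by (simp add: indicator_def)
    also have "\<dots> = emeasure lborel (f -` E)"
      using measurable_sets[OF fb E] by (intro nn_integral_indicator) simp
    finally show "emeasure lborel (f -` E) * indicator ?B y =
        (\<integral>\<^sup>+x. indicator E (f x + y) * indicator ?B y \<partial>lborel)"
      by (simp add: nn_integral_multc)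
  qed
  also have "\<dots> = (\<integral>\<^sup>+x. (\<integral>\<^sup>+y. indicator E (f x + y) * indicator ?B y \<partial>lborel) \<partial>lborel)"
    by (rule lborel_pair.Fubini'[OF m1])
  also have "\<dots> = (\<integral>\<^sup>+x. (\<integral>\<^sup>+y. indicator E y * indicator ?B (y - f x) \<partial>lborel) \<partial>lborel)"
  proof (rule nn_integral_cong)
    fix x :: "real ^ 'p"
    show "(\<integral>\<^sup>+y. indicator E (f x + y) * indicator ?B y \<partial>lborel) =
        (\<integral>\<^sup>+y. indicator E y * indicator ?B (y - f x) \<partial>lborel)"
    proof -
      have "(\<lambda>y. indicator E y * indicator ?B (y - f x) :: ennreal) \<in> borel_measurable borel"
        by (intro borel_measurable_times_ennreal indE measurable_compose[OF _ indB]
            borel_measurable_diff) measurable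
      from nn_integral_lborel_shift[OF this, of "f x"] show ?thesis
        by (simp add: add.commute)
    qed
  qed
  also have "\<dots> = (\<integral>\<^sup>+y. (\<integral>\<^sup>+x. indicator E y * indicator ?B (y - f x) \<partial>lborel) \<partial>lborel)"
    by (rule lborel_pair.Fubini'[OF m2, symmetric])
  also have "\<dots> = (\<integral>\<^sup>+y. indicator E y * emeasure lborel ?B \<partial>lborel)"
  proof (rule nn_integral_cong)
    fix y :: "real ^ 'p"
    have "norm (y - f x) = norm (x + - g y)" for x
    proof -
      have "y - f x = f (g y - x)" by (simp add: linear_diff[OF lin] g)
      then show ?thesis by (simp add: nf norm_minus_commute)
    qed
    then have "(\<integral>\<^sup>+x. indicator ?B (y - f x) \<partial>lborel) = (\<integral>\<^sup>+x. indicator ?B (x + - g y) \<partial>lborel)"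
      by (simp add: indicator_def)
    also have "\<dots> = (\<integral>\<^sup>+x. indicator ?B x \<partial>lborel)"
      by (rule nn_integral_lborel_shift[OF indB])
    finally have "(\<integral>\<^sup>+x. indicator ?B (y - f x) \<partial>lborel) = emeasure lborel ?B"
      by simp
    moreover have "(\<lambda>x. indicator ?B (y - f x) :: ennreal) \<in> borel_measurable lborel"
      by (intro measurable_compose[OF _ indB] borel_measurable_diff fl) measurable
    ultimately show "(\<integral>\<^sup>+x. indicator E y * indicator ?B (y - f x) \<partial>lborel) = indicator E y * emeasure lborel ?B"
      by (subst nn_integral_cmult) auto
  qed
  also have "\<dots> = emeasure lborel E * emeasure lborel ?B"
    by (simp add: nn_integral_multc)
  finally show ?thesis
    using emeasure_unit_ball_finite[where 'p='p]
    by (auto simp: mult.commute[of _ "emeasure lborel ?B"] ennreal_mult_cancel_left)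
qed

lemma sphere_measure_rotation_invariant:
  fixes f :: "real ^ 'p::finite \<Rightarrow> real ^ 'p"
  assumes f: "orthogonal_transformation f"
  shows "distr sphere_measure sphere_measure f = sphere_measure"
proof (rule measure_eqI)
  have lin: "linear f" and nf: "norm (f x) = norm x" for x
    using f by (auto simp: orthogonal_transformation_linear orthogonal_transformation_norm)
  have f0: "f x = 0 \<longleftrightarrow> x = 0" for x
    by (metis nf norm_eq_zero)
  have fb: "f \<in> borel \<rightarrow>\<^sub>M borel"
    using lin by (intro borel_measurable_continuous_onI linear_continuous_on)
      (simp add: linear_conv_bounded_linear)
  have fm: "f \<in> sphere_measure \<rightarrow>\<^sub>M sphere_measure"
    unfolding measurable_cong_sets[OF sets_sphere_measure sets_sphere_measure]
    by (rule measurable_restrict_space3[OF fb]) (auto simp: nf)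
  fix S :: "(real ^ 'p) set"
  assume "S \<in> sets (distr sphere_measure sphere_measure f)"
  then have S: "S \<in> sets sphere_measure" by simp
  let ?C = "\<lambda>S. {x \<in> ball 0 1 - {0 :: real ^ 'p}. sgn x \<in> S}"
  have CS: "?C S \<in> sets borel"
  proof -
    have S': "S \<in> sets borel"
      using S by (simp add: sets_sphere_measure sets_restrict_space_iff)
    have "(\<lambda>x :: real ^ 'p. x /\<^sub>R norm x) \<in> borel \<rightarrow>\<^sub>M borel"
      by simp
    from measurable_sets[OF this S'] have "sgn -` S \<in> sets borel"
      by (simp add: sgn_div_norm[abs_def])
    moreover have "?C S = (ball 0 1 - {0}) \<inter> sgn -` S" by auto
    ultimately show ?thesis by simp
  qed
  have "emeasure (distr sphere_measure sphere_measure f) S =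
      emeasure sphere_measure (f -` S \<inter> space sphere_measure)"
    using fm S by (rule emeasure_distr)
  also have "\<dots> = emeasure lborel (?C (f -` S \<inter> space sphere_measure)) / emeasure lborel (ball 0 1 :: (real ^ 'p) set)"
    using measurable_sets[OF fm S] by (rule emeasure_sphere_measure)
  also have "?C (f -` S \<inter> space sphere_measure) = f -` ?C S"
    by (auto simp: space_sphere_measure norm_sgn nf f0 sgn_div_norm linear_scale[OF lin])
  also have "emeasure lborel \<dots> = emeasure lborel (?C S)"
    using f CS by (rule emeasure_lborel_orthogonal_vimage)
  also have "\<dots> / emeasure lborel (ball 0 1 :: (real ^ 'p) set) = emeasure sphere_measure S"
    using emeasure_sphere_measure[OF S] by simp
  finally show "emeasure (distr sphere_measure sphere_measure f) S = emeasure sphere_measure S" .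
qed simp

section \<open>The Hausdorff metric and fuzzy random variables\<close>

text \<open>Outside \<open>Kc\<close> the value is irrelevant; \<open>0\<close> makes the function non-negative everywhere, as the
  locale \<open>Metric_space\<close> requires.\<close>

definition hausdorff :: "(real ^ 'p::finite) set \<Rightarrow> (real ^ 'p) set \<Rightarrow> real" where
  "hausdorff K L =
     (if K \<in> Kc \<and> L \<in> Kc
      then max (SUP x\<in>K. infdist x L) (SUP y\<in>L. infdist y K)
      else 0)"

lemma bdd_above_infdist: "compact K \<Longrightarrow> bdd_above ((\<lambda>x. infdist x L) ` K)"
  by (intro bounded_imp_bdd_above compact_imp_bounded compact_continuous_image continuous_on_infdist continuous_on_id)

lemma hausdorff_le_iff:
  assumes "K \<in> Kc" "L \<in> Kc"
  shows "hausdorff K L \<le> e \<longleftrightarrow> (\<forall>x\<in>K. infdist x L \<le> e) \<and> (\<forall>y\<in>L. infdist y K \<le> e)"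
  using assms by (auto simp: hausdorff_def Kc_def cSUP_le_iff bdd_above_infdist)

lemma Metric_space_hausdorff: "Metric_space Kc (hausdorff :: (real ^ 'p::finite) set \<Rightarrow> _)"
proof
  fix K L N :: "(real ^ 'p) set"
  show nn: "0 \<le> hausdorff K L" for K L :: "(real ^ 'p) set"
  proof (cases "K \<in> Kc \<and> L \<in> Kc")
    case True
    then obtain x where "x \<in> K" by (auto simp: Kc_def)
    have "infdist x L \<le> hausdorff K L"
      using hausdorff_le_iff[of K L "hausdorff K L"] True \<open>x \<in> K\<close> by auto
    then show ?thesis using infdist_nonneg[of x L] by linarith
  qed (auto simp: hausdorff_def)
  show "hausdorff K L = hausdorff L K"
    by (simp add: hausdorff_def max.commute)
  assume K: "K \<in> Kc" and L: "L \<in> Kc"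
  show "hausdorff K L = 0 \<longleftrightarrow> K = L"
  proof -
    have "hausdorff K L = 0 \<longleftrightarrow> hausdorff K L \<le> 0"
      using nn[of K L] by linarith
    also have "\<dots> \<longleftrightarrow> (\<forall>x\<in>K. infdist x L = 0) \<and> (\<forall>y\<in>L. infdist y K = 0)"
      by (simp add: hausdorff_le_iff[OF K L] order_antisym_conv infdist_nonneg)
    also have "\<dots> \<longleftrightarrow> K \<subseteq> L \<and> L \<subseteq> K"
      using K L in_closed_iff_infdist_zero[of K] in_closed_iff_infdist_zero[of L]
      by (auto simp: Kc_def compact_imp_closed subset_iff)
    also have "\<dots> \<longleftrightarrow> K = L" by auto
    finally show ?thesis .
  qed
  assume N: "N \<in> Kc"
  have tri: "infdist x N \<le> hausdorff K L + hausdorff L N"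
    if K: "K \<in> Kc" and L: "L \<in> Kc" and N: "N \<in> Kc" and x: "x \<in> K" for K L N :: "(real ^ 'p) set" and x
  proof -
    obtain y where y: "y \<in> L" "infdist x L = dist x y"
      using L infdist_attains_inf[of L x] by (auto simp: Kc_def compact_imp_closed)
    have "infdist x N \<le> infdist y N + dist x y"
      by (rule infdist_triangle)
    moreover have "dist x y \<le> hausdorff K L"
      using hausdorff_le_iff[OF K L, of "hausdorff K L"] x y by auto
    moreover have "infdist y N \<le> hausdorff L N"
      using hausdorff_le_iff[OF L N, of "hausdorff L N"] y by auto
    ultimately show ?thesis by linarith
  qed
  have comm: "hausdorff K L = hausdorff L K" for K L :: "(real ^ 'p) set"
    by (simp add: hausdorff_def max.commute)
  show "hausdorff K N \<le> hausdorff K L + hausdorff L N"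
    unfolding hausdorff_le_iff[OF K N]
    using tri[OF K L N] tri[OF N L K] comm[of K L] comm[of L N] by (simp add: add.commute)
qed

definition Kc_borel :: "(real ^ 'p::finite) set measure" where
  "Kc_borel = sigma Kc {U. openin (Metric_space.mtopology Kc hausdorff) U}"

definition fuzzy_rv :: "'w measure \<Rightarrow> ('w \<Rightarrow> 'p::finite fuzzy) \<Rightarrow> bool" where
  "fuzzy_rv M X \<longleftrightarrow>
     (\<forall>\<omega>\<in>space M. X \<omega> \<in> Fc) \<and>
     (\<forall>\<alpha>\<in>{0..1}. (\<lambda>\<omega>. level (X \<omega>) \<alpha>) \<in> M \<rightarrow>\<^sub>M Kc_borel)"

definition set_norm :: "(real ^ 'p::finite) set \<Rightarrow> real" where
  "set_norm K = (SUP x\<in>K. norm x)"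

definition Lr_fuzzy :: "'w measure \<Rightarrow> real \<Rightarrow> ('w \<Rightarrow> 'p::finite fuzzy) set" where
  "Lr_fuzzy M r = {X. fuzzy_rv M X \<and> integrable M (\<lambda>\<omega>. set_norm (level (X \<omega>) 0) powr r)}"

section \<open>Support functions, metrics and depths\<close>

text \<open>Functions on \<open>sphere 0 1 \<times> {0..1}\<close> are represented by functions on the whole product type; only
  their values on that set matter for the measure \<open>sphere_level_measure\<close>.\<close>

definition supp_fun :: "'p::finite fuzzy \<Rightarrow> (real ^ 'p) \<times> real \<Rightarrow> real" where
  "supp_fun A = (\<lambda>(u, \<alpha>). SUP v\<in>level A \<alpha>. u \<bullet> v)"

definition mid :: "((real ^ 'p::finite) \<times> real \<Rightarrow> real) \<Rightarrow> (real ^ 'p) \<times> real \<Rightarrow> real" where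
  "mid s = (\<lambda>(u, \<alpha>). (s (u, \<alpha>) - s (- u, \<alpha>)) / 2)"

definition spr :: "((real ^ 'p::finite) \<times> real \<Rightarrow> real) \<Rightarrow> (real ^ 'p) \<times> real \<Rightarrow> real" where
  "spr s = (\<lambda>(u, \<alpha>). (s (u, \<alpha>) + s (- u, \<alpha>)) / 2)"

definition sphere_level_measure :: "((real ^ 'p::finite) \<times> real) measure" where
  "sphere_level_measure = sphere_measure \<Otimes>\<^sub>M restrict_space lborel {0..1}"

definition Lr_norm :: "real \<Rightarrow> ((real ^ 'p::finite) \<times> real \<Rightarrow> real) \<Rightarrow> real" where
  "Lr_norm r f = (LINT z|sphere_level_measure. \<bar>f z\<bar> powr r) powr (1 / r)"

definition rho :: "real \<Rightarrow> 'p::finite fuzzy \<Rightarrow> 'p fuzzy \<Rightarrow> real" where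
  "rho r A B = Lr_norm r (supp_fun A - supp_fun B)"

definition dist_mid_spr :: "real \<Rightarrow> real \<Rightarrow> 'p::finite fuzzy \<Rightarrow> 'p fuzzy \<Rightarrow> real" where
  "dist_mid_spr r \<theta> A B =
     (Lr_norm r (mid (supp_fun A) - mid (supp_fun B)) powr r
      + \<theta> * Lr_norm r (spr (supp_fun A) - spr (supp_fun B)) powr r) powr (1 / r)"

definition location_depth ::
  "'w measure \<Rightarrow> real \<Rightarrow> real \<Rightarrow> 'p::finite fuzzy \<Rightarrow> ('w \<Rightarrow> 'p fuzzy) \<Rightarrow> real" where
  "location_depth M r \<theta> A X = inverse (1 + (LINT \<omega>|M. dist_mid_spr r \<theta> A (X \<omega>)))"

definition location_raised_depth ::
  "'w measure \<Rightarrow> real \<Rightarrow> real \<Rightarrow> 'p::finite fuzzy \<Rightarrow> ('w \<Rightarrow> 'p fuzzy) \<Rightarrow> real" where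
  "location_raised_depth M r \<theta> A X = inverse (1 + (LINT \<omega>|M. dist_mid_spr r \<theta> A (X \<omega>) powr r))"

end

theory Submission
  imports Defs
begin

text \<open>
  Both depths have the form \<open>1 / (1 + c(B))\<close>, where \<open>c(B)\<close> is the expectation of
  \<open>d(B, X)\<^sup>e\<close> for the metric \<open>d\<close> with exponent \<open>r\<close> and weight \<open>\<theta>\<close>; here \<open>e = 1\<close> for the
  location depth and \<open>e = r\<close> for the raised depth. So a deepest \<open>A\<close> is a minimizer of \<open>c\<close>, and only
  \<open>e \<ge> 1\<close> and \<open>E \<parallel>X\<^sub>0\<parallel>\<^sup>e < \<infinity>\<close> matter. This treats the two depths in one argument.

  The distance \<open>d(A, B)\<close> is a norm (a seminorm when \<open>\<theta> = 0\<close>) of the support function difference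
  \<open>s\<^sub>A - s\<^sub>B\<close>, namely a weighted \<open>L\<^sup>r\<close> norm of the pair formed by its mid and its spread, and support
  functions turn the fuzzy sum and non-negative multiples into the pointwise operations
  (\<open>supp_fun_add\<close>, \<open>supp_fun_scale\<close>). Hence, if \<open>A\<close> is deepest and
  \<open>s\<^sub>C = (1 - l) s\<^sub>A + l s\<^sub>B\<close> almost everywhere, Minkowski's inequality and the convexity of
  \<open>t \<mapsto> t\<^sup>e\<close> give \<open>c(C) \<le> (1 - l) c(A) + l c(B) \<le> c(B)\<close> (\<open>cost_between_le\<close>). For convex
  combinations of \<open>A\<close> with other fuzzy sets this is the monotonicity of the depth along segments.
  For a fuzzy set that is between \<open>A\<close> and \<open>V\<close> only in the sense of a metric, with \<open>\<theta> > 0\<close>, equality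
  in the triangle inequality of an \<open>L\<^sup>s\<close> norm with \<open>s > 1\<close> makes the two differences proportional,
  because \<open>\<bar>x\<bar>\<^sup>s\<close> is strictly convex; so its support function is almost everywhere on the segment
  between those of \<open>A\<close> and \<open>V\<close>, whichever \<open>s\<close> and whichever of the two metrics is meant
  (\<open>ae_between_if_metric_between\<close>).

  For the depths that vanish at infinity, the triangle inequality gives
  \<open>c(B) \<ge> d(B, A) - c(A) - 2\<close> (\<open>cost_ge\<close>), so it suffices that \<open>d(B, A)\<close> tends to infinity. Along
  \<open>A + \<lambda> U\<close> this distance is \<open>\<lambda>\<close> times the norm of \<open>s\<^sub>U\<close>, which is positive since \<open>s\<^sub>U > 0\<close> on a set of
  positive measure when \<open>U\<close> is not the indicator of the origin (\<open>pair_norm_supp_fun_pos\<close>). For a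
  sequence that diverges in another metric, with exponent \<open>s \<le> r\<close>, that metric is bounded in terms of
  \<open>d\<close> because \<open>x\<^sup>s \<le> 1 + x\<^sup>r\<close> (\<open>metric_powr_le_dist_mid_spr_powr\<close>).

  All of this requires the expectations to be those of integrable functions. That rests on the joint
  measurability of \<open>(\<omega>, u, \<alpha>) \<mapsto> s\<^bsub>X(\<omega>)\<^esub>(u, \<alpha>)\<close> (\<open>measurable_supp_fun_joint\<close>), which follows from
  the Lipschitz continuity in \<open>u\<close> and the left continuity in \<open>\<alpha>\<close>.
\<close>

section \<open>A weighted Minkowski inequality and its equality case\<close>

lemma Bernoulli_powr_strict:
  fixes s z :: real
  assumes s: "1 < s" and z: "0 \<le> z" "z \<noteq> 1"
  shows "1 + s * (z - 1) < z powr s"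
proof (cases "z = 0")
  case True
  then show ?thesis using s by simp
next
  case False
  with z have z0: "0 < z" by simp
  have der: "((\<lambda>x. x powr s) has_real_derivative s * x powr (s - 1)) (at x)" if "0 < x" for x
    using that by (auto intro!: derivative_eq_intros)
  show ?thesis
  proof (cases "z < 1")
    case True
    obtain \<xi> where \<xi>: "z < \<xi>" "\<xi> < 1" and eq: "1 powr s - z powr s = (1 - z) * (s * \<xi> powr (s - 1))"
      using MVT2[OF True, of "\<lambda>x. x powr s" "\<lambda>x. s * x powr (s - 1)"] der z0 by force
    have "\<xi> powr (s - 1) < 1 powr (s - 1)"
      using \<xi> z0 s by (intro powr_less_mono2) auto
    then have "(1 - z) * (s * \<xi> powr (s - 1)) < (1 - z) * s"
      using True s by simp
    then show ?thesis using eq by (simp add: algebra_simps)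
  next
    case False
    then have z1: "1 < z" using z by simp
    obtain \<xi> where \<xi>: "1 < \<xi>" "\<xi> < z" and eq: "z powr s - 1 powr s = (z - 1) * (s * \<xi> powr (s - 1))"
      using MVT2[OF z1, of "\<lambda>x. x powr s" "\<lambda>x. s * x powr (s - 1)"] der by force
    have "1 powr (s - 1) < \<xi> powr (s - 1)"
      using \<xi> s by (intro powr_less_mono2) auto
    then have "(z - 1) * s < (z - 1) * (s * \<xi> powr (s - 1))"
      using z1 s by simp
    then show ?thesis using eq by (simp add: algebra_simps)
  qed
qed

text \<open>The inequality of Bernoulli, rescaled: the graph of \<open>z \<mapsto> z\<^sup>s\<close> lies above its tangent at \<open>m\<close>, and touches
  it only there when \<open>s > 1\<close>.\<close>

lemma powr_above_tangent:
  fixes s m z :: real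
  assumes s: "1 \<le> s" and m: "0 < m" and z: "0 \<le> z"
  shows "m powr s * (1 + s * (z / m - 1)) \<le> z powr s"
    and "1 < s \<Longrightarrow> z \<noteq> m \<Longrightarrow> m powr s * (1 + s * (z / m - 1)) < z powr s"
proof -
  have zs: "z powr s = m powr s * (z / m) powr s"
    using m z by (simp add: powr_divide)
  have ms: "0 < m powr s" using m by simp
  show strict: "m powr s * (1 + s * (z / m - 1)) < z powr s" if "1 < s" "z \<noteq> m"
    unfolding zs using Bernoulli_powr_strict[of s "z / m"] that m z ms by simp
  show "m powr s * (1 + s * (z / m - 1)) \<le> z powr s"
  proof (cases "1 < s \<and> z \<noteq> m")
    case True
    then show ?thesis using strict by auto
  next
    case False
    then have "s = 1 \<or> z = m" using s by auto
    then show ?thesis using m z by auto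
  qed
qed

text \<open>Averaging the tangent inequality at \<open>m = (1 - t) \<bar>x\<bar> + t \<bar>y\<bar>\<close> over \<open>\<bar>x\<bar>\<close> and \<open>\<bar>y\<bar>\<close> cancels the linear term.
  It is strict unless \<open>\<bar>x\<bar> = \<bar>y\<bar>\<close>; and if \<open>y = - x \<noteq> 0\<close>, cancellation within \<open>(1 - t) x + t y\<close> makes the
  inequality strict.\<close>

lemma abs_powr_convex:
  fixes s t x y :: real
  assumes s: "1 \<le> s" and t: "0 < t" "t < 1"
  shows "\<bar>(1 - t) * x + t * y\<bar> powr s \<le> (1 - t) * \<bar>x\<bar> powr s + t * \<bar>y\<bar> powr s"
    and "1 < s \<Longrightarrow> x \<noteq> y \<Longrightarrow>
      \<bar>(1 - t) * x + t * y\<bar> powr s < (1 - t) * \<bar>x\<bar> powr s + t * \<bar>y\<bar> powr s"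
proof -
  define m where "m = (1 - t) * \<bar>x\<bar> + t * \<bar>y\<bar>"
  have m0: "0 \<le> m" using t by (simp add: m_def)
  have "\<bar>(1 - t) * x + t * y\<bar> \<le> \<bar>(1 - t) * x\<bar> + \<bar>t * y\<bar>" by (rule abs_triangle_ineq)
  then have le: "\<bar>(1 - t) * x + t * y\<bar> \<le> m" using t by (simp add: m_def abs_mult)
  have tangent: "(1 - t) * (m powr s * (1 + s * (\<bar>x\<bar> / m - 1))) + t * (m powr s * (1 + s * (\<bar>y\<bar> / m - 1))) = m powr s"
    if "0 < m"
  proof -
    have "(1 - t) * (\<bar>x\<bar> / m) + t * (\<bar>y\<bar> / m) = 1"
      using that unfolding m_def by (simp add: add_divide_distrib[symmetric])
    then have "(1 - t) * (1 + s * (\<bar>x\<bar> / m - 1)) + t * (1 + s * (\<bar>y\<bar> / m - 1)) = 1"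
      by algebra
    then show ?thesis by algebra
  qed
  have mle: "m powr s \<le> (1 - t) * \<bar>x\<bar> powr s + t * \<bar>y\<bar> powr s"
  proof (cases "m = 0")
    case True
    then show ?thesis using t s by simp
  next
    case False
    then have m: "0 < m" using m0 by simp
    show ?thesis
      using powr_above_tangent(1)[OF s m, of "\<bar>x\<bar>"] powr_above_tangent(1)[OF s m, of "\<bar>y\<bar>"] t
      by (subst tangent[OF m, symmetric]) (intro add_mono mult_left_mono; simp)
  qed
  have lep: "\<bar>(1 - t) * x + t * y\<bar> powr s \<le> m powr s"
    using le s by (intro powr_mono2) auto
  show "\<bar>(1 - t) * x + t * y\<bar> powr s \<le> (1 - t) * \<bar>x\<bar> powr s + t * \<bar>y\<bar> powr s"
    using lep mle by linarith
  assume s1: "1 < s" and xy: "x \<noteq> y"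
  show "\<bar>(1 - t) * x + t * y\<bar> powr s < (1 - t) * \<bar>x\<bar> powr s + t * \<bar>y\<bar> powr s"
  proof (cases "\<bar>x\<bar> = \<bar>y\<bar>")
    case True
    with xy have y: "y = - x" and x: "x \<noteq> 0" by (auto simp: abs_eq_iff)
    have m: "m = \<bar>x\<bar>" using True by (simp add: m_def algebra_simps)
    have "(1 - t) * x + t * y = (1 - 2 * t) * x" by (simp add: y algebra_simps)
    then have "\<bar>(1 - t) * x + t * y\<bar> = \<bar>1 - 2 * t\<bar> * \<bar>x\<bar>" by (simp add: abs_mult)
    also have "\<dots> < 1 * \<bar>x\<bar>" using t x by (intro mult_strict_right_mono) auto
    finally have "\<bar>(1 - t) * x + t * y\<bar> powr s < m powr s"
      using s1 m by (intro powr_less_mono2) auto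
    then show ?thesis using mle by linarith
  next
    case False
    have m: "0 < m"
    proof -
      have "x \<noteq> 0 \<or> y \<noteq> 0" using xy by auto
      then have "m \<noteq> 0"
        using t by (simp add: m_def add_nonneg_eq_0_iff)
      then show ?thesis using m0 by simp
    qed
    have "\<bar>x\<bar> - m = t * (\<bar>x\<bar> - \<bar>y\<bar>)" by (simp add: m_def algebra_simps)
    then have "\<bar>x\<bar> \<noteq> m" using False t by auto
    then have "m powr s < (1 - t) * \<bar>x\<bar> powr s + t * \<bar>y\<bar> powr s"
      using powr_above_tangent(2)[OF s m, of "\<bar>x\<bar>"] powr_above_tangent(1)[OF s m, of "\<bar>y\<bar>"] t s1
      by (subst tangent[OF m, symmetric]) (intro add_less_le_mono mult_left_mono mult_strict_left_mono; simp)
    then show ?thesis using lep by linarith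
  qed
qed

text \<open>The value at \<open>p = \<bar>x\<bar>\<^sup>s\<close>, \<open>q = \<bar>y\<bar>\<^sup>s\<close> is the bound for \<open>\<bar>x + y\<bar>\<^sup>s\<close> that convexity yields when \<open>(x + y) / (a + b)\<close>
  is read as the average of \<open>x / a\<close> and \<open>y / b\<close> with weights proportional to \<open>a\<close> and \<open>b\<close>. It is linear
  in \<open>(p, q)\<close>, so it can be integrated term by term.\<close>

definition split_bound :: "real \<Rightarrow> real \<Rightarrow> real \<Rightarrow> real \<Rightarrow> real \<Rightarrow> real" where
  "split_bound s a b p q = (a + b) powr s * (a / (a + b) * (p / a powr s) + b / (a + b) * (q / b powr s))"

lemma abs_add_powr_le_split_bound:
  fixes s a b x y :: real
  assumes s: "1 \<le> s" and a: "0 < a" and b: "0 < b"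
  shows "\<bar>x + y\<bar> powr s \<le> split_bound s a b (\<bar>x\<bar> powr s) (\<bar>y\<bar> powr s)"
    and "1 < s \<Longrightarrow> b * x \<noteq> a * y \<Longrightarrow> \<bar>x + y\<bar> powr s < split_bound s a b (\<bar>x\<bar> powr s) (\<bar>y\<bar> powr s)"
proof -
  define t where "t = b / (a + b)"
  have t: "0 < t" "t < 1" and t': "1 - t = a / (a + b)"
    using a b by (auto simp: t_def field_simps)
  have "(1 - t) * (x / a) + t * (y / b) = (x + y) / (a + b)"
  proof -
    have "(1 - t) * (x / a) = x / (a + b)" unfolding t' using a by simp
    moreover have "t * (y / b) = y / (a + b)" unfolding t_def using b by simp
    ultimately show ?thesis by (simp add: add_divide_distrib)
  qed
  then have eq: "\<bar>x + y\<bar> powr s = (a + b) powr s * \<bar>(1 - t) * (x / a) + t * (y / b)\<bar> powr s"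
    using a b by (simp add: powr_divide)
  have xs: "\<bar>x / a\<bar> powr s = \<bar>x\<bar> powr s / a powr s" and ys: "\<bar>y / b\<bar> powr s = \<bar>y\<bar> powr s / b powr s"
    using a b by (auto simp: powr_divide)
  have bound: "split_bound s a b (\<bar>x\<bar> powr s) (\<bar>y\<bar> powr s)
      = (a + b) powr s * ((1 - t) * \<bar>x / a\<bar> powr s + t * \<bar>y / b\<bar> powr s)"
    unfolding split_bound_def xs ys t' unfolding t_def ..
  have pos: "0 < (a + b) powr s" using a b by simp
  show "\<bar>x + y\<bar> powr s \<le> split_bound s a b (\<bar>x\<bar> powr s) (\<bar>y\<bar> powr s)"
    unfolding eq bound by (intro mult_left_mono abs_powr_convex(1)[OF s t] less_imp_le[OF pos])
  assume "1 < s" "b * x \<noteq> a * y"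
  then show "\<bar>x + y\<bar> powr s < split_bound s a b (\<bar>x\<bar> powr s) (\<bar>y\<bar> powr s)"
    unfolding eq bound using abs_powr_convex(2)[OF s t, of "x / a" "y / b"] pos a b
    by (intro mult_strict_left_mono) (auto simp: field_simps)
qed

definition powr_integrable :: "'a measure \<Rightarrow> real \<Rightarrow> ('a \<Rightarrow> real) \<Rightarrow> bool" where
  "powr_integrable N s f \<longleftrightarrow> f \<in> borel_measurable N \<and> integrable N (\<lambda>x. \<bar>f x\<bar> powr s)"

text \<open>Weighting the second function by \<open>\<theta>\<close> serves both kinds of metric at once: the pair of mid and
  spread gives the metric with parameter \<open>\<theta>\<close>, and a single function paired with \<open>0\<close>, for
  \<open>\<theta> = 0\<close>, gives an ordinary \<open>L\<^sup>s\<close> norm.\<close>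

definition pair_mass :: "'a measure \<Rightarrow> real \<Rightarrow> real \<Rightarrow> ('a \<Rightarrow> real) \<Rightarrow> ('a \<Rightarrow> real) \<Rightarrow> real" where
  "pair_mass N s \<theta> f g = (LINT x|N. \<bar>f x\<bar> powr s) + \<theta> * (LINT x|N. \<bar>g x\<bar> powr s)"

definition pair_norm :: "'a measure \<Rightarrow> real \<Rightarrow> real \<Rightarrow> ('a \<Rightarrow> real) \<Rightarrow> ('a \<Rightarrow> real) \<Rightarrow> real" where
  "pair_norm N s \<theta> f g = pair_mass N s \<theta> f g powr (1 / s)"

lemma pair_mass_nonneg: "0 \<le> \<theta> \<Longrightarrow> 0 \<le> pair_mass N s \<theta> f g"
  by (simp add: pair_mass_def)

lemma pair_norm_nonneg: "0 \<le> pair_norm N s \<theta> f g"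
  by (simp add: pair_norm_def)

lemma pair_norm_powr:
  assumes "1 \<le> s" "0 \<le> \<theta>"
  shows "pair_norm N s \<theta> f g powr s = pair_mass N s \<theta> f g"
  using assms pair_mass_nonneg[of \<theta> N s f g] by (simp add: pair_norm_def powr_powr)

text \<open>The bound with \<open>a = b = 1\<close> is an integrable majorant.\<close>

lemma powr_integrable_add:
  assumes s: "1 \<le> s" and f: "powr_integrable N s f" and g: "powr_integrable N s g"
  shows "powr_integrable N s (\<lambda>x. f x + g x)"
  unfolding powr_integrable_def
proof
  have [measurable]: "f \<in> borel_measurable N" "g \<in> borel_measurable N"
    and int: "integrable N (\<lambda>x. \<bar>f x\<bar> powr s)" "integrable N (\<lambda>x. \<bar>g x\<bar> powr s)"
    using f g by (auto simp: powr_integrable_def)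
  show "(\<lambda>x. f x + g x) \<in> borel_measurable N" by measurable
  show "integrable N (\<lambda>x. \<bar>f x + g x\<bar> powr s)"
  proof (rule Bochner_Integration.integrable_bound)
    show "integrable N (\<lambda>x. split_bound s 1 1 (\<bar>f x\<bar> powr s) (\<bar>g x\<bar> powr s))"
      unfolding split_bound_def using int by auto
    show "AE x in N. norm (\<bar>f x + g x\<bar> powr s) \<le> norm (split_bound s 1 1 (\<bar>f x\<bar> powr s) (\<bar>g x\<bar> powr s))"
      using abs_add_powr_le_split_bound(1)[OF s, of 1 1]
      by (auto intro!: AE_I2 order_trans[OF _ abs_ge_self])
  qed measurable
qed

lemma powr_integrable_cmult:
  assumes "powr_integrable N s f"
  shows "powr_integrable N s (\<lambda>x. c * f x)"
  using assms by (auto simp: powr_integrable_def abs_mult powr_mult)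

lemma powr_integrable_AE_zero:
  assumes f: "powr_integrable N s f" and zero: "(LINT x|N. \<bar>f x\<bar> powr s) = 0"
  shows "AE x in N. f x = 0"
proof -
  have "AE x in N. \<bar>f x\<bar> powr s = 0"
    using f zero by (subst integral_nonneg_eq_0_iff_AE[symmetric]) (auto simp: powr_integrable_def)
  then show ?thesis by simp
qed

lemma pair_norm_cong_AE:
  assumes "AE x in N. f x = f' x" "AE x in N. g x = g' x"
    and "f \<in> borel_measurable N" "f' \<in> borel_measurable N" "g \<in> borel_measurable N" "g' \<in> borel_measurable N"
  shows "pair_norm N s \<theta> f g = pair_norm N s \<theta> f' g'"
proof -
  have "(LINT x|N. \<bar>f x\<bar> powr s) = (LINT x|N. \<bar>f' x\<bar> powr s)"
    using assms by (intro integral_cong_AE) auto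
  moreover have "(LINT x|N. \<bar>g x\<bar> powr s) = (LINT x|N. \<bar>g' x\<bar> powr s)"
    using assms by (intro integral_cong_AE) auto
  ultimately show ?thesis by (simp add: pair_norm_def pair_mass_def)
qed

lemma pair_norm_scale:
  assumes "1 \<le> s" "0 \<le> \<theta>"
  shows "pair_norm N s \<theta> (\<lambda>x. c * f x) (\<lambda>x. c * g x) = \<bar>c\<bar> * pair_norm N s \<theta> f g"
proof -
  have "pair_mass N s \<theta> (\<lambda>x. c * f x) (\<lambda>x. c * g x) = \<bar>c\<bar> powr s * pair_mass N s \<theta> f g"
    by (simp add: pair_mass_def abs_mult powr_mult distrib_left mult.left_commute)
  then show ?thesis
    using assms pair_mass_nonneg[of \<theta> N s f g] by (simp add: pair_norm_def powr_mult powr_powr)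
qed

lemma pair_norm_eq_0D:
  assumes "0 \<le> \<theta>" and f: "powr_integrable N s f" and g: "powr_integrable N s g"
    and zero: "pair_norm N s \<theta> f g = 0"
  shows "AE x in N. f x = 0" and "0 < \<theta> \<Longrightarrow> AE x in N. g x = 0"
proof -
  have "pair_mass N s \<theta> f g = 0" using zero by (simp add: pair_norm_def)
  moreover have "0 \<le> (LINT x|N. \<bar>f x\<bar> powr s)" "0 \<le> \<theta> * (LINT x|N. \<bar>g x\<bar> powr s)"
    using assms(1) by auto
  ultimately have "(LINT x|N. \<bar>f x\<bar> powr s) = 0" "\<theta> * (LINT x|N. \<bar>g x\<bar> powr s) = 0"
    unfolding pair_mass_def by linarith+
  then show "AE x in N. f x = 0" and "0 < \<theta> \<Longrightarrow> AE x in N. g x = 0"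
    using powr_integrable_AE_zero f g by auto
qed

text \<open>With \<open>a\<close> and \<open>b\<close> the two norms, the pointwise bound integrates exactly to \<open>(a + b)\<^sup>s\<close>. If the norm of
  the sum is \<open>a + b\<close>, then the pointwise inequality is an equality almost everywhere, which for
  \<open>s > 1\<close> forces \<open>b f = a f'\<close>, and \<open>b g = a g'\<close> when the second component counts.\<close>

lemma pair_norm_triangle_pos:
  fixes f f' g g' :: "'a \<Rightarrow> real"
  defines "h \<equiv> \<lambda>x. f x + f' x" and "k \<equiv> \<lambda>x. g x + g' x"
  assumes s: "1 \<le> s" and \<theta>: "0 \<le> \<theta>"
    and f: "powr_integrable N s f" "powr_integrable N s f'"
    and g: "powr_integrable N s g" "powr_integrable N s g'"
    and a: "a = pair_norm N s \<theta> f g" "0 < a" and b: "b = pair_norm N s \<theta> f' g'" "0 < b"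
  shows "pair_norm N s \<theta> h k \<le> a + b"
    and "1 < s \<Longrightarrow> pair_norm N s \<theta> h k = a + b \<Longrightarrow> AE x in N. b * f x = a * f' x"
    and "1 < s \<Longrightarrow> 0 < \<theta> \<Longrightarrow> pair_norm N s \<theta> h k = a + b \<Longrightarrow> AE x in N. b * g x = a * g' x"
proof -
  let ?S = "split_bound s a b"
  have massa: "pair_mass N s \<theta> f g = a powr s" and massb: "pair_mass N s \<theta> f' g' = b powr s"
    unfolding a(1) b(1) pair_norm_powr[OF s \<theta>] by (rule refl)+
  have ints: "integrable N (\<lambda>x. \<bar>f x\<bar> powr s)" "integrable N (\<lambda>x. \<bar>f' x\<bar> powr s)"
    "integrable N (\<lambda>x. \<bar>g x\<bar> powr s)" "integrable N (\<lambda>x. \<bar>g' x\<bar> powr s)"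
    using f g by (auto simp: powr_integrable_def)
  have h: "powr_integrable N s h" and k: "powr_integrable N s k"
    unfolding h_def k_def using f g s by (auto intro: powr_integrable_add)
  have inth: "integrable N (\<lambda>x. \<bar>h x\<bar> powr s)" and intk: "integrable N (\<lambda>x. \<bar>k x\<bar> powr s)"
    using h k by (auto simp: powr_integrable_def)
  \<comment> \<open>The non-negative defects of the pointwise bound in the two components.\<close>
  define F where "F x = ?S (\<bar>f x\<bar> powr s) (\<bar>f' x\<bar> powr s) - \<bar>h x\<bar> powr s" for x
  define G where "G x = ?S (\<bar>g x\<bar> powr s) (\<bar>g' x\<bar> powr s) - \<bar>k x\<bar> powr s" for x
  have F0: "0 \<le> F x" and G0: "0 \<le> G x" for x
    unfolding F_def G_def h_def k_def using abs_add_powr_le_split_bound(1)[OF s a(2) b(2)] by auto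
  have intF: "integrable N F" and intG: "integrable N G"
    unfolding F_def[abs_def] G_def[abs_def] split_bound_def using ints inth intk by auto
  have IF: "(LINT x|N. F x) = ?S (LINT x|N. \<bar>f x\<bar> powr s) (LINT x|N. \<bar>f' x\<bar> powr s) - (LINT x|N. \<bar>h x\<bar> powr s)"
    and IG: "(LINT x|N. G x) = ?S (LINT x|N. \<bar>g x\<bar> powr s) (LINT x|N. \<bar>g' x\<bar> powr s) - (LINT x|N. \<bar>k x\<bar> powr s)"
    unfolding F_def G_def split_bound_def using ints inth intk by simp_all
  have lin: "?S p q + \<theta> * ?S p' q' = ?S (p + \<theta> * p') (q + \<theta> * q')" for p q p' q'
    by (simp add: split_bound_def add_divide_distrib algebra_simps)
  have "?S (pair_mass N s \<theta> f g) (pair_mass N s \<theta> f' g') = (a + b) powr s"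
    using a(2) b(2) by (simp add: massa massb split_bound_def add_divide_distrib[symmetric])
  then have total: "(LINT x|N. F x) + \<theta> * (LINT x|N. G x) = (a + b) powr s - pair_mass N s \<theta> h k"
    unfolding IF IG pair_mass_def lin[symmetric] by (simp add: algebra_simps)
  have IF0: "0 \<le> (LINT x|N. F x)" and IG0: "0 \<le> \<theta> * (LINT x|N. G x)"
    using F0 G0 \<theta> by auto
  then have "pair_mass N s \<theta> h k \<le> (a + b) powr s" using total by linarith
  then have "pair_norm N s \<theta> h k \<le> ((a + b) powr s) powr (1 / s)"
    unfolding pair_norm_def using pair_mass_nonneg[OF \<theta>] s by (intro powr_mono2) auto
  then show "pair_norm N s \<theta> h k \<le> a + b"
    using s a(2) b(2) by (simp add: powr_powr)
  assume s1: "1 < s" and eq: "pair_norm N s \<theta> h k = a + b"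
  have "pair_mass N s \<theta> h k = (a + b) powr s"
    unfolding pair_norm_powr[OF s \<theta>, symmetric] eq ..
  then have F_zero: "(LINT x|N. F x) = 0" and G_zero: "\<theta> * (LINT x|N. G x) = 0"
    using total IF0 IG0 by linarith+
  have "AE x in N. F x = 0"
    using F_zero intF F0 by (subst integral_nonneg_eq_0_iff_AE[symmetric]) auto
  then show "AE x in N. b * f x = a * f' x"
  proof eventually_elim
    case (elim x)
    show ?case
      using abs_add_powr_le_split_bound(2)[OF s a(2) b(2) s1, of "f x" "f' x"] elim
      unfolding F_def h_def by force
  qed
  assume "0 < \<theta>"
  with G_zero have "(LINT x|N. G x) = 0" by simp
  then have "AE x in N. G x = 0"
    using intG G0 by (subst integral_nonneg_eq_0_iff_AE[symmetric]) auto
  then show "AE x in N. b * g x = a * g' x"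
  proof eventually_elim
    case (elim x)
    show ?case
      using abs_add_powr_le_split_bound(2)[OF s a(2) b(2) s1, of "g x" "g' x"] elim
      unfolding G_def k_def by force
  qed
qed

lemma pair_norm_add_null:
  assumes \<theta>: "0 \<le> \<theta>"
    and f: "powr_integrable N s f" "powr_integrable N s f'"
    and g: "powr_integrable N s g" "powr_integrable N s g'"
    and null: "pair_norm N s \<theta> f g = 0"
  shows "pair_norm N s \<theta> (\<lambda>x. f x + f' x) (\<lambda>x. g x + g' x) = pair_norm N s \<theta> f' g'"
proof -
  note AE = pair_norm_eq_0D[OF \<theta> f(1) g(1) null]
  have m: "f \<in> borel_measurable N" "f' \<in> borel_measurable N" "g \<in> borel_measurable N" "g' \<in> borel_measurable N"
    using f g by (auto simp: powr_integrable_def)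
  have fe: "AE x in N. f x + f' x = f' x" using AE(1) by eventually_elim simp
  show ?thesis
  proof (cases "\<theta> = 0")
    case True
    have "(LINT x|N. \<bar>f x + f' x\<bar> powr s) = (LINT x|N. \<bar>f' x\<bar> powr s)"
      using fe m by (intro integral_cong_AE) auto
    then show ?thesis using True by (simp add: pair_norm_def pair_mass_def)
  next
    case False
    then have "AE x in N. g x = 0" using AE(2) \<theta> by simp
    then have "AE x in N. g x + g' x = g' x" by eventually_elim simp
    then show ?thesis using fe m by (intro pair_norm_cong_AE) auto
  qed
qed

lemma pair_norm_triangle:
  assumes s: "1 \<le> s" and \<theta>: "0 \<le> \<theta>"
    and f: "powr_integrable N s f" "powr_integrable N s f'"
    and g: "powr_integrable N s g" "powr_integrable N s g'"
  shows "pair_norm N s \<theta> (\<lambda>x. f x + f' x) (\<lambda>x. g x + g' x) \<le> pair_norm N s \<theta> f g + pair_norm N s \<theta> f' g'"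
proof -
  consider "pair_norm N s \<theta> f g = 0" | "pair_norm N s \<theta> f' g' = 0"
    | "0 < pair_norm N s \<theta> f g" "0 < pair_norm N s \<theta> f' g'"
    using pair_norm_nonneg less_eq_real_def by metis
  then show ?thesis
  proof cases
    case 1
    then show ?thesis using pair_norm_add_null[OF \<theta> f g] by simp
  next
    case 2
    then show ?thesis using pair_norm_add_null[OF \<theta> f(2,1) g(2,1)] by (simp add: add.commute)
  next
    case 3
    show ?thesis by (rule pair_norm_triangle_pos(1)[OF s \<theta> f g refl 3(1) refl 3(2)])
  qed
qed

text \<open>If one of the norms vanishes, the function concerned is null and the proportionality is trivial;
  otherwise it comes from the strict convexity in the positive case.\<close>

lemma pair_norm_triangle_equality:
  fixes f f' g g' :: "'a \<Rightarrow> real" and N :: "'a measure" and s \<theta> :: real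
  defines "a \<equiv> pair_norm N s \<theta> f g" and "b \<equiv> pair_norm N s \<theta> f' g'"
  assumes s: "1 < s" and \<theta>: "0 \<le> \<theta>"
    and f: "powr_integrable N s f" "powr_integrable N s f'"
    and g: "powr_integrable N s g" "powr_integrable N s g'"
    and eq: "pair_norm N s \<theta> (\<lambda>x. f x + f' x) (\<lambda>x. g x + g' x) = a + b"
  shows "AE x in N. b * f x = a * f' x"
    and "0 < \<theta> \<Longrightarrow> AE x in N. b * g x = a * g' x"
proof -
  have "(AE x in N. b * f x = a * f' x) \<and> (0 < \<theta> \<longrightarrow> (AE x in N. b * g x = a * g' x))"
  proof -
    consider "a = 0" | "b = 0" | "0 < a" "0 < b"
      unfolding a_def b_def using pair_norm_nonneg less_eq_real_def by metis
    then show ?thesis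
    proof cases
      case 1
      then show ?thesis
        using pair_norm_eq_0D[OF \<theta> f(1) g(1)] unfolding a_def by auto
    next
      case 2
      then show ?thesis
        using pair_norm_eq_0D[OF \<theta> f(2) g(2)] unfolding b_def by auto
    next
      case 3
      show ?thesis
        using pair_norm_triangle_pos(2,3)[OF less_imp_le[OF s] \<theta> f g _ 3(1) _ 3(2)] eq s
        unfolding a_def b_def by auto
    qed
  qed
  then show "AE x in N. b * f x = a * f' x" and "0 < \<theta> \<Longrightarrow> AE x in N. b * g x = a * g' x"
    by auto
qed

section \<open>Levels of fuzzy sums and multiples\<close>

lemma Fc_range:
  assumes "A \<in> Fc"
  shows "0 \<le> A x" "A x \<le> 1"
  using assms by (auto simp: Fc_def)

lemma level_Kc: "A \<in> Fc \<Longrightarrow> \<alpha> \<in> {0..1} \<Longrightarrow> level A \<alpha> \<in> Kc"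
  by (simp add: Fc_def)

lemma level_nonempty_compact_convex:
  assumes "A \<in> Fc" "\<alpha> \<in> {0..1}"
  shows "level A \<alpha> \<noteq> {}" "compact (level A \<alpha>)" "convex (level A \<alpha>)"
  using level_Kc[OF assms] by (auto simp: Kc_def)

lemma in_level_iff: "0 < \<alpha> \<Longrightarrow> x \<in> level A \<alpha> \<longleftrightarrow> \<alpha> \<le> A x"
  by (simp add: level_def)

lemma level_antimono:
  assumes "0 \<le> \<alpha>" "\<alpha> \<le> \<beta>"
  shows "level A \<beta> \<subseteq> level A \<alpha>"
proof (cases "\<alpha> = 0")
  case True
  show ?thesis
  proof (cases "\<beta> = 0")
    case False
    then have "{x. \<beta> \<le> A x} \<subseteq> {x. 0 < A x}" using assms by auto
    then show ?thesis
      using True False closure_subset unfolding level_def by auto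
  qed (use True in simp)
qed (use assms in \<open>auto simp: level_def\<close>)

lemma FcI_levels:
  assumes range: "\<And>x. 0 \<le> C x" "\<And>x. C x \<le> 1"
    and lev: "\<And>\<alpha>. \<alpha> \<in> {0..1} \<Longrightarrow> level C \<alpha> \<in> Kc"
  shows "C \<in> Fc"
  using assms by (auto simp: Fc_def)

text \<open>The level at \<open>\<alpha>\<close> is the intersection of the levels below \<open>\<alpha>\<close>; by compactness, a decreasing family
  of non-empty compact subsets of the lower levels leaves a common point at level \<open>\<alpha>\<close>. This is the source both of
  the attainment of the supremum in a fuzzy sum and of the left continuity of support functions.\<close>

lemma Inter_nested_levels:
  fixes A :: "'p::finite fuzzy"
  assumes \<alpha>: "0 < \<alpha>"
    and K: "\<And>\<beta>. 0 < \<beta> \<Longrightarrow> \<beta> < \<alpha> \<Longrightarrow> compact (K \<beta>) \<and> K \<beta> \<noteq> {}"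
    and mono: "\<And>\<beta> \<gamma>. 0 < \<beta> \<Longrightarrow> \<beta> \<le> \<gamma> \<Longrightarrow> \<gamma> < \<alpha> \<Longrightarrow> K \<gamma> \<subseteq> K \<beta>"
    and sub: "\<And>\<beta>. 0 < \<beta> \<Longrightarrow> \<beta> < \<alpha> \<Longrightarrow> K \<beta> \<subseteq> level A \<beta>"
  obtains x where "x \<in> level A \<alpha>" "\<And>\<beta>. 0 < \<beta> \<Longrightarrow> \<beta> < \<alpha> \<Longrightarrow> x \<in> K \<beta>"
proof -
  \<comment> \<open>The shift by 2 keeps the levels strictly positive.\<close>
  define \<beta> where "\<beta> n = \<alpha> - \<alpha> / (real n + 2)" for n :: nat
  have \<beta>: "0 < \<beta> n" "\<beta> n < \<alpha>" for n
    using \<alpha> by (auto simp: \<beta>_def field_simps intro: add_pos_nonneg)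
  have \<beta>_mono: "\<beta> m \<le> \<beta> n" if "m \<le> n" for m n
    using that \<alpha> by (auto simp: \<beta>_def intro!: divide_left_mono)
  have "\<Inter>(range (\<lambda>n. K (\<beta> n))) \<noteq> {}"
    using K \<beta> by (intro compact_nest mono \<beta>_mono) auto
  then obtain x where x: "\<And>n. x \<in> K (\<beta> n)" by auto
  have ex: "\<exists>n. \<gamma> < \<beta> n" if "\<gamma> < \<alpha>" for \<gamma>
  proof -
    have "\<beta> \<longlonglongrightarrow> \<alpha>" unfolding \<beta>_def[abs_def] by real_asymp
    then have "eventually (\<lambda>n. \<gamma> < \<beta> n) sequentially"
      using that by (rule order_tendstoD)
    then show ?thesis by (auto simp: eventually_sequentially)
  qed
  have xK: "x \<in> K \<gamma>" if "0 < \<gamma>" "\<gamma> < \<alpha>" for \<gamma>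
    using ex[OF that(2)] mono[OF that(1), of "\<beta> _"] x \<beta> that by (metis less_imp_le subsetD)
  have "\<alpha> \<le> A x"
  proof (rule ccontr)
    assume "\<not> \<alpha> \<le> A x"
    then obtain n where "A x < \<beta> n" using ex[of "A x"] by auto
    moreover have "\<beta> n \<le> A x"
      using sub[OF \<beta>, of n] x[of n] in_level_iff[OF \<beta>(1)] by auto
    ultimately show False by simp
  qed
  then show ?thesis using that xK \<alpha> by (simp add: in_level_iff)
qed

lemma compact_set_plus:
  fixes K L :: "'a::real_normed_vector set"
  assumes "compact K" "compact L"
  shows "compact (K + L)"
proof -
  have "K + L = {x + y | x y. x \<in> K \<and> y \<in> L}" by (auto simp: set_plus_def)
  then show ?thesis using compact_sums[OF assms] by simp
qed

lemma fuzzy_add_gt_iff: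
  fixes A B :: "'p::finite fuzzy"
  assumes A: "A \<in> Fc" and B: "B \<in> Fc"
  shows "c < fuzzy_add A B t \<longleftrightarrow> (\<exists>x. c < A x \<and> c < B (t - x))"
proof -
  have ne: "{min (A x) (B y) | x y. x + y = t} \<noteq> {}"
    by (auto intro: exI[of _ t] exI[of _ 0])
  have bdd: "bdd_above {min (A x) (B y) | x y. x + y = t}"
    using Fc_range(2)[OF A] by (intro bdd_aboveI[of _ 1]) (auto simp: min_le_iff_disj)
  have "c < fuzzy_add A B t \<longleftrightarrow> (\<exists>x y. x + y = t \<and> c < min (A x) (B y))"
    unfolding fuzzy_add_def less_cSup_iff[OF ne bdd] by blast
  also have "\<dots> \<longleftrightarrow> (\<exists>x. c < A x \<and> c < B (t - x))"
  proof -
    have "x + y = t \<longleftrightarrow> y = t - x" for x y by (auto simp: algebra_simps)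
    then show ?thesis by auto
  qed
  finally show ?thesis .
qed

lemma fuzzy_add_range:
  fixes A B :: "'p::finite fuzzy"
  assumes A: "A \<in> Fc" and B: "B \<in> Fc"
  shows "fuzzy_add A B t \<le> 1" and "0 \<le> fuzzy_add A B t"
proof -
  have "\<not> 1 < fuzzy_add A B t"
    unfolding fuzzy_add_gt_iff[OF A B] using Fc_range(2)[OF A] by (auto simp: not_less)
  then show "fuzzy_add A B t \<le> 1" by simp
  show "0 \<le> fuzzy_add A B t"
  proof (rule dense_le)
    fix c :: real assume "c < 0"
    then have "c < A t \<and> c < B (t - t)"
      using Fc_range(1)[OF A] Fc_range(1)[OF B] by (auto intro: less_le_trans)
    then have "c < fuzzy_add A B t" unfolding fuzzy_add_gt_iff[OF A B] by blast
    then show "c \<le> fuzzy_add A B t" by simp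
  qed
qed

text \<open>At \<open>\<alpha> > 0\<close> the supremum defining the sum has to be attained: the points \<open>x\<close> with \<open>x\<close> in the
  \<open>\<beta>\<close>-level of \<open>A\<close> and \<open>t - x\<close> in that of \<open>B\<close> form a nested compact family for \<open>\<beta> < \<alpha>\<close>. At \<open>\<alpha> = 0\<close> the sets where the
  membership is positive add up, and the closure of a sum of bounded sets is the sum of the closures.\<close>

lemma level_fuzzy_add:
  fixes A B :: "'p::finite fuzzy"
  assumes A: "A \<in> Fc" and B: "B \<in> Fc" and \<alpha>: "\<alpha> \<in> {0..1}"
  shows "level (fuzzy_add A B) \<alpha> = level A \<alpha> + level B \<alpha>"
proof (cases "\<alpha> = 0")
  case True
  let ?P = "\<lambda>C :: 'p fuzzy. {x. 0 < C x}"
  have sum: "?P (fuzzy_add A B) = ?P A + ?P B"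
  proof -
    have "t = x + y \<longleftrightarrow> y = t - x" for t x y :: "real ^ 'p" by (auto simp: algebra_simps)
    then show ?thesis unfolding fuzzy_add_gt_iff[OF A B] set_plus_def by auto
  qed
  have "compact (closure (?P A))" "compact (closure (?P B))"
    using level_nonempty_compact_convex(2)[OF A, of 0] level_nonempty_compact_convex(2)[OF B, of 0] by (auto simp: level_def)
  then have "closed (closure (?P A) + closure (?P B))"
    by (intro compact_imp_closed compact_set_plus)
  moreover have "?P A + ?P B \<subseteq> closure (?P A) + closure (?P B)"
    by (intro set_plus_mono2 closure_subset)
  ultimately have "closure (?P A + ?P B) \<subseteq> closure (?P A) + closure (?P B)"
    by (rule closure_minimal[rotated])
  then have "closure (?P A + ?P B) = closure (?P A) + closure (?P B)"
    using closure_sum[of "?P A" "?P B"] by auto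
  then show ?thesis by (simp add: True level_def sum)
next
  case False
  then have \<alpha>0: "0 < \<alpha>" and \<alpha>1: "\<alpha> \<le> 1" using \<alpha> by auto
  show ?thesis
  proof (intro equalityI subsetI)
    fix t assume "t \<in> level (fuzzy_add A B) \<alpha>"
    then have t: "\<alpha> \<le> fuzzy_add A B t" using \<alpha>0 by (simp add: in_level_iff)
    define K where "K \<beta> = level A \<beta> \<inter> (\<lambda>y. t - y) ` level B \<beta>" for \<beta>
    have K_iff: "x \<in> K \<beta> \<longleftrightarrow> \<beta> \<le> A x \<and> \<beta> \<le> B (t - x)" if "0 < \<beta>" for x \<beta>
    proof -
      have "x \<in> (\<lambda>y. t - y) ` level B \<beta> \<longleftrightarrow> t - x \<in> level B \<beta>"
        by (auto intro: image_eqI[of _ _ "t - x"])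
      then show ?thesis using that by (simp add: K_def in_level_iff)
    qed
    obtain x where x: "x \<in> level A \<alpha>" and xK: "\<And>\<beta>. 0 < \<beta> \<Longrightarrow> \<beta> < \<alpha> \<Longrightarrow> x \<in> K \<beta>"
    proof (rule Inter_nested_levels[OF \<alpha>0, of K])
      fix \<beta> :: real assume \<beta>: "0 < \<beta>" "\<beta> < \<alpha>"
      then have "\<beta> \<in> {0..1}" using \<alpha>1 by auto
      then have "compact (K \<beta>)"
        unfolding K_def using level_nonempty_compact_convex(2)[OF A] level_nonempty_compact_convex(2)[OF B]
        by (intro compact_Int compact_continuous_image continuous_intros) auto
      moreover have "\<beta> < fuzzy_add A B t" using \<beta> t by simp
      then obtain x where "\<beta> < A x" "\<beta> < B (t - x)" unfolding fuzzy_add_gt_iff[OF A B] by auto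
      then have "x \<in> K \<beta>" using K_iff[OF \<beta>(1)] by simp
      ultimately show "compact (K \<beta>) \<and> K \<beta> \<noteq> {}" by auto
      show "K \<beta> \<subseteq> level A \<beta>" by (auto simp: K_def)
    qed (auto simp: K_iff)
    have "\<alpha> \<le> B (t - x)"
    proof (rule dense_le_bounded[OF \<alpha>0])
      fix \<beta> assume "0 < \<beta>" "\<beta> < \<alpha>"
      then show "\<beta> \<le> B (t - x)" using xK K_iff by auto
    qed
    then have "t - x \<in> level B \<alpha>" using \<alpha>0 by (simp add: in_level_iff)
    then have "x + (t - x) \<in> level A \<alpha> + level B \<alpha>" using x by (intro set_plus_intro)
    then show "t \<in> level A \<alpha> + level B \<alpha>" by simp
  next
    fix t assume "t \<in> level A \<alpha> + level B \<alpha>"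
    then obtain x y where xy: "t = x + y" "\<alpha> \<le> A x" "\<alpha> \<le> B y"
      using \<alpha>0 by (auto simp: in_level_iff elim!: set_plus_elim)
    have "\<alpha> \<le> fuzzy_add A B t"
    proof (rule dense_le)
      fix c assume "c < \<alpha>"
      then have "c < A x \<and> c < B (t - x)" using xy by auto
      then have "c < fuzzy_add A B t" unfolding fuzzy_add_gt_iff[OF A B] by blast
      then show "c \<le> fuzzy_add A B t" by simp
    qed
    then show "t \<in> level (fuzzy_add A B) \<alpha>" using \<alpha>0 by (simp add: in_level_iff)
  qed
qed

lemma fuzzy_add_Fc:
  fixes A B :: "'p::finite fuzzy"
  assumes A: "A \<in> Fc" and B: "B \<in> Fc"
  shows "fuzzy_add A B \<in> Fc"
proof (rule FcI_levels)
  fix \<alpha> :: real assume \<alpha>: "\<alpha> \<in> {0..1}"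
  note a = level_nonempty_compact_convex[OF A \<alpha>] and b = level_nonempty_compact_convex[OF B \<alpha>]
  have "compact (level A \<alpha> + level B \<alpha>)"
    using a b by (intro compact_set_plus)
  moreover have "level A \<alpha> + level B \<alpha> \<noteq> {}"
    using a(1) b(1) by (auto intro: set_plus_intro)
  ultimately show "level (fuzzy_add A B) \<alpha> \<in> Kc"
    using a b by (simp add: level_fuzzy_add[OF A B \<alpha>] Kc_def convex_set_plus)
qed (use fuzzy_add_range[OF A B] in auto)

lemma level_crisp_zero:
  assumes "0 \<le> \<alpha>" "\<alpha> \<le> 1"
  shows "level (crisp_zero :: 'p::finite fuzzy) \<alpha> = {0}"
proof -
  have "{x :: real ^ 'p. (0::real) < indicator {0} x} = {0}"
    by (auto simp: indicator_def)
  then show ?thesis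
    using assms by (auto simp: level_def crisp_zero_def indicator_def split: if_splits)
qed

lemma fuzzy_scale_pos:
  assumes A: "A \<in> Fc" and c: "0 < c"
  shows "fuzzy_scale c A t = A (t /\<^sub>R c)"
proof -
  have "{A x | x. c *\<^sub>R x = t} = {A (t /\<^sub>R c)}"
    using c by (auto intro: exI[of _ "t /\<^sub>R c"])
  then show ?thesis
    using Fc_range(1)[OF A] by (simp add: fuzzy_scale_def) (intro cSup_eq_maximum; auto)
qed

lemma level_fuzzy_scale:
  fixes A :: "'p::finite fuzzy"
  assumes A: "A \<in> Fc" and c: "0 \<le> c" and \<alpha>: "\<alpha> \<in> {0..1}"
  shows "level (fuzzy_scale c A) \<alpha> = (\<lambda>x. c *\<^sub>R x) ` level A \<alpha>"
proof (cases "c = 0")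
  case True
  then show ?thesis
    using level_nonempty_compact_convex(1)[OF A \<alpha>] \<alpha> by (auto simp: fuzzy_scale_zero[OF A] level_crisp_zero)
next
  case False
  then have c0: "0 < c" using c by simp
  have im: "{t. P (t /\<^sub>R c)} = (\<lambda>x. c *\<^sub>R x) ` {x. P x}" for P :: "real ^ 'p \<Rightarrow> bool"
    using c0 by (auto intro!: image_eqI[of _ _ "_ /\<^sub>R c"])
  show ?thesis
  proof (cases "\<alpha> = 0")
    case True
    show ?thesis
      unfolding level_def fuzzy_scale_pos[OF A c0, abs_def] using True im[of "\<lambda>x. 0 < A x"]
      by (simp add: closure_scaleR)
  next
    case False
    then show ?thesis
      unfolding level_def fuzzy_scale_pos[OF A c0, abs_def] using im[of "\<lambda>x. \<alpha> \<le> A x"] by simp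
  qed
qed

lemma fuzzy_scale_Fc:
  fixes A :: "'p::finite fuzzy"
  assumes A: "A \<in> Fc" and c: "0 \<le> c"
  shows "fuzzy_scale c A \<in> Fc"
proof (rule FcI_levels)
  fix x
  show "0 \<le> fuzzy_scale c A x" "fuzzy_scale c A x \<le> 1"
    using Fc_range[OF A] c fuzzy_scale_pos[OF A] fuzzy_scale_zero[OF A]
    by (cases "c = 0"; auto simp: crisp_zero_def indicator_def)+
next
  fix \<alpha> :: real assume \<alpha>: "\<alpha> \<in> {0..1}"
  show "level (fuzzy_scale c A) \<alpha> \<in> Kc"
    using level_nonempty_compact_convex[OF A \<alpha>]
    by (simp add: level_fuzzy_scale[OF A c \<alpha>] Kc_def convex_scaling compact_scaling)
qed

section \<open>Support functions\<close>

definition support :: "(real ^ 'p::finite) set \<Rightarrow> real ^ 'p \<Rightarrow> real" where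
  "support K u = (SUP v\<in>K. u \<bullet> v)"

lemma supp_fun_eq_support: "supp_fun A (u, \<alpha>) = support (level A \<alpha>) u"
  by (simp add: supp_fun_def support_def)

lemma bdd_above_inner:
  fixes K :: "'a::real_inner set"
  assumes "compact K"
  shows "bdd_above ((\<bullet>) u ` K)"
  using assms by (intro bounded_imp_bdd_above compact_imp_bounded compact_continuous_image continuous_intros)

lemma inner_le_support: "compact K \<Longrightarrow> v \<in> K \<Longrightarrow> u \<bullet> v \<le> support K u"
  unfolding support_def by (intro cSUP_upper bdd_above_inner)

lemma support_le: "K \<noteq> {} \<Longrightarrow> (\<And>v. v \<in> K \<Longrightarrow> u \<bullet> v \<le> c) \<Longrightarrow> support K u \<le> c"
  unfolding support_def by (intro cSUP_least)

lemma support_attained: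
  assumes "compact K" "K \<noteq> {}"
  obtains v where "v \<in> K" "support K u = u \<bullet> v"
proof -
  have "continuous_on K (\<lambda>v. u \<bullet> v)" by (intro continuous_intros)
  from continuous_attains_sup[OF assms this]
  obtain v where v: "v \<in> K" "\<And>y. y \<in> K \<Longrightarrow> u \<bullet> y \<le> u \<bullet> v" by auto
  then have "support K u = u \<bullet> v"
    using assms by (intro antisym support_le inner_le_support)
  then show ?thesis using that v by blast
qed

lemma support_add:
  assumes K: "compact K" "K \<noteq> {}" and L: "compact L" "L \<noteq> {}"
  shows "support (K + L) u = support K u + support L u"
proof (rule antisym)
  show "support (K + L) u \<le> support K u + support L u"
    using K L by (intro support_le) (auto elim!: set_plus_elim simp: inner_add_right intro!: add_mono inner_le_support set_plus_intro)
  obtain v w where v: "v \<in> K" "support K u = u \<bullet> v" and w: "w \<in> L" "support L u = u \<bullet> w"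
    using support_attained K L by metis
  have "compact (K + L)"
    using K L by (intro compact_set_plus)
  then have "u \<bullet> (v + w) \<le> support (K + L) u"
    using v w by (intro inner_le_support) auto
  then show "support K u + support L u \<le> support (K + L) u"
    by (simp add: v w inner_add_right)
qed

lemma support_scale:
  assumes K: "compact K" "K \<noteq> {}" and c: "0 \<le> c"
  shows "support ((\<lambda>x. c *\<^sub>R x) ` K) u = c * support K u"
proof (rule antisym)
  show "support ((\<lambda>x. c *\<^sub>R x) ` K) u \<le> c * support K u"
    using K c by (intro support_le) (auto intro!: mult_left_mono inner_le_support)
  obtain v where v: "v \<in> K" "support K u = u \<bullet> v"
    using support_attained K by metis
  then have "u \<bullet> (c *\<^sub>R v) \<le> support ((\<lambda>x. c *\<^sub>R x) ` K) u"
    using K by (intro inner_le_support compact_scaling) auto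
  then show "c * support K u \<le> support ((\<lambda>x. c *\<^sub>R x) ` K) u"
    by (simp add: v)
qed

lemma supp_fun_add:
  assumes "A \<in> Fc" "B \<in> Fc" "\<alpha> \<in> {0..1}"
  shows "supp_fun (fuzzy_add A B) (u, \<alpha>) = supp_fun A (u, \<alpha>) + supp_fun B (u, \<alpha>)"
  using assms by (simp add: supp_fun_eq_support level_fuzzy_add support_add level_nonempty_compact_convex del: atLeastAtMost_iff)

lemma supp_fun_scale:
  assumes "A \<in> Fc" "0 \<le> c" "\<alpha> \<in> {0..1}"
  shows "supp_fun (fuzzy_scale c A) (u, \<alpha>) = c * supp_fun A (u, \<alpha>)"
  using assms by (simp add: supp_fun_eq_support level_fuzzy_scale support_scale level_nonempty_compact_convex del: atLeastAtMost_iff)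

lemma norm_le_set_norm: "compact K \<Longrightarrow> v \<in> K \<Longrightarrow> norm v \<le> set_norm K"
  unfolding set_norm_def
  by (intro cSUP_upper bounded_imp_bdd_above compact_imp_bounded compact_continuous_image continuous_intros)

lemma set_norm_nonneg:
  assumes "A \<in> Fc"
  shows "0 \<le> set_norm (level A 0)"
proof -
  obtain v where v: "v \<in> level A 0" using level_nonempty_compact_convex(1)[OF assms, of 0] by auto
  show ?thesis
    by (rule order_trans[OF norm_ge_zero norm_le_set_norm[OF level_nonempty_compact_convex(2)[OF assms] v]]) simp
qed

lemma supp_fun_Lipschitz:
  assumes A: "A \<in> Fc" and \<alpha>: "\<alpha> \<in> {0..1}"
  shows "\<bar>supp_fun A (u, \<alpha>) - supp_fun A (u', \<alpha>)\<bar> \<le> norm (u - u') * set_norm (level A 0)"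
proof -
  note a = level_nonempty_compact_convex[OF A \<alpha>]
  have le: "support (level A \<alpha>) u \<le> support (level A \<alpha>) u' + norm (u - u') * set_norm (level A 0)" for u u'
  proof (rule support_le[OF a(1)])
    fix v assume v: "v \<in> level A \<alpha>"
    then have "v \<in> level A 0" using level_antimono[of 0 \<alpha> A] \<alpha> by auto
    then have "norm v \<le> set_norm (level A 0)"
      using level_nonempty_compact_convex(2)[OF A, of 0] by (intro norm_le_set_norm) auto
    then have "(u - u') \<bullet> v \<le> norm (u - u') * set_norm (level A 0)"
      by (meson norm_cauchy_schwarz mult_left_mono norm_ge_zero order_trans)
    moreover have "u \<bullet> v = u' \<bullet> v + (u - u') \<bullet> v" by (simp add: inner_diff_left)
    ultimately show "u \<bullet> v \<le> support (level A \<alpha>) u' + norm (u - u') * set_norm (level A 0)"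
      using inner_le_support[OF a(2) v, of u'] by linarith
  qed
  show ?thesis
    using le[of u u'] le[of u' u] by (simp add: supp_fun_eq_support norm_minus_commute abs_le_iff)
qed

lemma abs_supp_fun_le:
  assumes A: "A \<in> Fc" and \<alpha>: "\<alpha> \<in> {0..1}" and u: "norm u = 1"
  shows "\<bar>supp_fun A (u, \<alpha>)\<bar> \<le> set_norm (level A 0)"
proof -
  have "supp_fun A (0, \<alpha>) = 0"
    using level_nonempty_compact_convex(1)[OF A \<alpha>] by (simp add: supp_fun_def)
  then show ?thesis using supp_fun_Lipschitz[OF A \<alpha>, of u 0] u by simp
qed

lemma supp_fun_antimono:
  assumes A: "A \<in> Fc" and "0 \<le> \<alpha>" "\<alpha> \<le> \<beta>" "\<beta> \<le> 1"
  shows "supp_fun A (u, \<beta>) \<le> supp_fun A (u, \<alpha>)"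
  unfolding supp_fun_eq_support
  using assms level_antimono[of \<alpha> \<beta> A] level_nonempty_compact_convex[OF A]
  by (intro support_le inner_le_support) auto

text \<open>Otherwise the points of the levels \<open>\<beta> < \<alpha>\<close> with inner product at least \<open>s\<^sub>A(u, \<alpha>) + e\<close> would be
  non-empty, nested and compact, and a common point would lie in the \<open>\<alpha>\<close>-level.\<close>

lemma supp_fun_left_continuous:
  fixes A :: "'p::finite fuzzy"
  assumes A: "A \<in> Fc" and \<alpha>: "\<alpha> \<in> {0..1}"
    and an: "\<And>n. an n \<in> {0..\<alpha>}" and lim: "an \<longlonglongrightarrow> \<alpha>"
  shows "(\<lambda>n. supp_fun A (u, an n)) \<longlonglongrightarrow> supp_fun A (u, \<alpha>)"
proof (cases "\<alpha> = 0")
  case True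
  then have "an n = 0" for n using an[of n] by simp
  then show ?thesis using True by simp
next
  case False
  then have \<alpha>0: "0 < \<alpha>" and \<alpha>1: "\<alpha> \<le> 1" using \<alpha> by auto
  show ?thesis
  proof (rule LIMSEQ_I)
    fix e :: real assume e: "0 < e"
    obtain \<beta> where \<beta>: "0 < \<beta>" "\<beta> < \<alpha>" and small: "supp_fun A (u, \<beta>) < supp_fun A (u, \<alpha>) + e"
    proof (rule ccontr)
      assume "\<not> thesis"
      then have big: "supp_fun A (u, \<alpha>) + e \<le> supp_fun A (u, \<beta>)" if "0 < \<beta>" "\<beta> < \<alpha>" for \<beta>
        using \<open>\<And>\<beta>. 0 < \<beta> \<Longrightarrow> \<beta> < \<alpha> \<Longrightarrow> supp_fun A (u, \<beta>) < supp_fun A (u, \<alpha>) + e \<Longrightarrow> thesis\<close> that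
        by force
      define K where "K \<beta> = level A \<beta> \<inter> {v. supp_fun A (u, \<alpha>) + e \<le> u \<bullet> v}" for \<beta>
      obtain v where v: "v \<in> level A \<alpha>" and vK: "\<And>\<beta>. 0 < \<beta> \<Longrightarrow> \<beta> < \<alpha> \<Longrightarrow> v \<in> K \<beta>"
      proof (rule Inter_nested_levels[OF \<alpha>0, of K])
        fix \<beta> :: real assume \<beta>: "0 < \<beta>" "\<beta> < \<alpha>"
        then have b: "level A \<beta> \<noteq> {}" "compact (level A \<beta>)"
          using level_nonempty_compact_convex[OF A, of \<beta>] \<alpha>1 by auto
        obtain w where "w \<in> level A \<beta>" "support (level A \<beta>) u = u \<bullet> w"
          using support_attained[OF b(2,1)] by metis
        then have "w \<in> K \<beta>" using big[OF \<beta>] by (simp add: K_def supp_fun_eq_support)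
        moreover have "compact (K \<beta>)"
          unfolding K_def using b(2)
          by (intro compact_Int_closed closed_Collect_le continuous_intros)
        ultimately show "compact (K \<beta>) \<and> K \<beta> \<noteq> {}" by auto
        show "K \<beta> \<subseteq> level A \<beta>" by (auto simp: K_def)
      next
        fix \<beta> \<gamma> :: real assume "0 < \<beta>" "\<beta> \<le> \<gamma>" "\<gamma> < \<alpha>"
        then show "K \<gamma> \<subseteq> K \<beta>" using level_antimono[of \<beta> \<gamma> A] by (auto simp: K_def)
      qed blast
      have "supp_fun A (u, \<alpha>) + e \<le> u \<bullet> v"
        using vK[of "\<alpha> / 2"] \<alpha>0 by (simp add: K_def)
      moreover have "u \<bullet> v \<le> supp_fun A (u, \<alpha>)"
        unfolding supp_fun_eq_support by (rule inner_le_support[OF level_nonempty_compact_convex(2)[OF A \<alpha>] v])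
      ultimately show False using e by simp
    qed
    have "eventually (\<lambda>n. \<beta> < an n) sequentially"
      by (rule order_tendstoD(1)[OF lim \<beta>(2)])
    then obtain N where N: "\<And>n. N \<le> n \<Longrightarrow> \<beta> < an n" by (auto simp: eventually_sequentially)
    have "norm (supp_fun A (u, an n) - supp_fun A (u, \<alpha>)) < e" if "N \<le> n" for n
    proof -
      have "supp_fun A (u, an n) \<le> supp_fun A (u, \<beta>)"
        using N[OF that] an[of n] \<beta> \<alpha>1 by (intro supp_fun_antimono[OF A]) auto
      moreover have "supp_fun A (u, \<alpha>) \<le> supp_fun A (u, an n)"
        using an[of n] \<alpha>1 by (intro supp_fun_antimono[OF A]) auto
      ultimately show ?thesis using small by simp
    qed
    then show "\<exists>N. \<forall>n\<ge>N. norm (supp_fun A (u, an n) - supp_fun A (u, \<alpha>)) < e" by auto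
  qed
qed

section \<open>Measurability of support functions\<close>

lemma support_Lipschitz_hausdorff:
  assumes K: "K \<in> Kc" and L: "L \<in> Kc"
  shows "\<bar>support K u - support L u\<bar> \<le> norm u * hausdorff K L"
proof -
  have le: "support K u \<le> support L u + norm u * hausdorff K L" if K: "K \<in> Kc" and L: "L \<in> Kc" for K L
  proof (rule support_le)
    show "K \<noteq> {}" using K by (simp add: Kc_def)
    fix v assume v: "v \<in> K"
    obtain y where y: "y \<in> L" "infdist v L = dist v y"
      using L infdist_attains_inf[of L v] by (auto simp: Kc_def compact_imp_closed)
    have "dist v y \<le> hausdorff K L"
      using hausdorff_le_iff[OF K L, of "hausdorff K L"] v y by auto
    then have "norm u * norm (v - y) \<le> norm u * hausdorff K L"
      by (intro mult_left_mono) (auto simp: dist_norm)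
    then have "u \<bullet> (v - y) \<le> norm u * hausdorff K L"
      by (rule order_trans[OF norm_cauchy_schwarz])
    moreover have "u \<bullet> y \<le> support L u"
      using L y by (intro inner_le_support) (auto simp: Kc_def)
    ultimately show "u \<bullet> v \<le> support L u + norm u * hausdorff K L"
      by (simp add: inner_diff_right)
  qed
  have "hausdorff L K = hausdorff K L" by (simp add: hausdorff_def max.commute)
  then show ?thesis using le[OF K L] le[OF L K] by (simp add: abs_le_iff)
qed

lemma Kc_borel_basics:
  shows space_Kc_borel: "space (Kc_borel :: (real ^ 'p::finite) set measure) = Kc"
    and openin_sets_Kc_borel:
      "\<And>U :: (real ^ 'p) set set. openin (Metric_space.mtopology Kc hausdorff) U \<Longrightarrow> U \<in> sets Kc_borel"
proof -
  interpret H: Metric_space Kc "hausdorff :: (real ^ 'p) set \<Rightarrow> _"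
    by (rule Metric_space_hausdorff)
  have sub: "{U. openin H.mtopology U} \<subseteq> Pow Kc"
    using openin_subset[of H.mtopology] by auto
  show "space (Kc_borel :: (real ^ 'p) set measure) = Kc"
    by (simp add: Kc_borel_def space_measure_of[OF sub])
  show "U \<in> sets Kc_borel" if "openin H.mtopology U" for U :: "(real ^ 'p) set set"
    using that by (auto simp: Kc_borel_def sets_measure_of[OF sub])
qed

text \<open>Lipschitz continuity for the Hausdorff metric makes preimages of open sets open.\<close>

lemma measurable_support:
  "(\<lambda>K. support K u) \<in> borel_measurable (Kc_borel :: (real ^ 'p::finite) set measure)"
proof (rule borel_measurableI)
  interpret H: Metric_space Kc "hausdorff :: (real ^ 'p) set \<Rightarrow> _"
    by (rule Metric_space_hausdorff)
  fix S :: "real set" assume S: "open S"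
  let ?U = "(\<lambda>K. support K u) -` S \<inter> Kc"
  have "openin H.mtopology ?U"
    unfolding H.openin_mtopology
  proof (intro conjI allI impI)
    fix K assume K: "K \<in> ?U"
    then obtain e where e: "0 < e" and ball: "ball (support K u) e \<subseteq> S"
      using S by (auto simp: open_contains_ball)
    define r where "r = e / (norm u + 1)"
    have r: "0 < r" using e by (simp add: r_def add_nonneg_pos)
    have "H.mball K r \<subseteq> ?U"
    proof
      fix L assume "L \<in> H.mball K r"
      then have L: "L \<in> Kc" "hausdorff K L < r" by (auto simp: H.in_mball)
      have "\<bar>support K u - support L u\<bar> \<le> norm u * hausdorff K L"
        using K L by (intro support_Lipschitz_hausdorff) auto
      also have "\<dots> \<le> norm u * r" using L by (intro mult_left_mono) auto
      also have "\<dots> < (norm u + 1) * r" using r by simp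
      also have "\<dots> = e" using norm_ge_zero[of u] by (simp add: r_def add_nonneg_eq_0_iff)
      finally have "support L u \<in> S" using ball by (auto simp: dist_real_def)
      then show "L \<in> ?U" using L by simp
    qed
    then show "\<exists>r>0. H.mball K r \<subseteq> ?U" using r by blast
  qed auto
  then show "(\<lambda>K. support K u) -` S \<inter> space Kc_borel \<in> sets (Kc_borel :: (real ^ 'p) set measure)"
    unfolding space_Kc_borel by (rule openin_sets_Kc_borel)
qed

lemma space_level_interval: "space (restrict_space lborel {0..1::real}) = {0..1}"
  by (simp add: space_restrict_space)

lemma space_sphere_level: "space sphere_level_measure = sphere 0 1 \<times> {0..1}"
  by (simp add: sphere_level_measure_def space_pair_measure space_sphere_measure space_level_interval)

lemma prob_space_sphere_level: "prob_space (sphere_level_measure :: ((real ^ 'p::finite) \<times> real) measure)"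
proof -
  interpret S: prob_space "sphere_measure :: (real ^ 'p) measure"
    by (rule prob_space_sphere_measure)
  interpret L: prob_space "restrict_space lborel {0..1::real}"
    by (rule prob_space_restrict_space) auto
  interpret pair_prob_space "sphere_measure :: (real ^ 'p) measure" "restrict_space lborel {0..1::real}" ..
  show ?thesis unfolding sphere_level_measure_def by (rule prob_space_axioms)
qed

lemma measurable_fst_sphere_level:
  "fst \<in> (sphere_level_measure :: ((real ^ 'p::finite) \<times> real) measure) \<rightarrow>\<^sub>M sphere_measure"
  unfolding sphere_level_measure_def by simp

lemma measurable_snd_sphere_level:
  "snd \<in> borel_measurable (sphere_level_measure :: ((real ^ 'p::finite) \<times> real) measure)"
proof -
  have "(\<lambda>x. x) \<in> borel_measurable (restrict_space lborel {0..1::real})"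
    by (intro measurable_restrict_space1) simp
  from measurable_compose[OF measurable_snd this] show ?thesis
    unfolding sphere_level_measure_def .
qed

lemma measurable_ident_sphere: "(\<lambda>u. u) \<in> borel_measurable (sphere_measure :: (real ^ 'p::finite) measure)"
  unfolding measurable_cong_sets[OF sets_sphere_measure refl]
  by (intro measurable_restrict_space1) simp

text \<open>At fixed \<open>(v, \<beta>)\<close> the value is a continuous function of the level, hence measurable in \<open>\<omega>\<close>. For the
  joint statement, \<open>u\<close> is approximated by simple functions and \<open>\<alpha>\<close> is rounded down to a multiple of
  \<open>1 / (n + 1)\<close>; each approximation takes countably many values. Rounding down is what the left continuity
  in \<open>\<alpha>\<close> asks for, and the Lipschitz constant in \<open>u\<close>, the same for all levels, lets both limits be taken
  together.\<close>

lemma measurable_supp_fun_joint: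
  fixes X :: "'w \<Rightarrow> 'p::finite fuzzy"
  assumes X: "fuzzy_rv N X"
  shows "(\<lambda>(\<omega>, z). supp_fun (X \<omega>) z) \<in> borel_measurable (N \<Otimes>\<^sub>M sphere_level_measure)"
proof -
  let ?P = "N \<Otimes>\<^sub>M (sphere_level_measure :: ((real ^ 'p) \<times> real) measure)"
  obtain F :: "nat \<Rightarrow> real ^ 'p \<Rightarrow> real ^ 'p" where F_all: "\<forall>n. simple_function sphere_measure (F n)"
    and F_lim_all: "\<forall>u\<in>space sphere_measure. (\<lambda>n. F n u) \<longlonglongrightarrow> u"
    using borel_measurable_implies_sequence_metric[OF measurable_ident_sphere, of 0] by blast
  have F: "simple_function sphere_measure (F n)" for n using F_all by blast
  have F_lim: "(\<lambda>n. F n u) \<longlonglongrightarrow> u" if "u \<in> sphere 0 1" for u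
    using F_lim_all that by (simp add: space_sphere_measure)
  define k where "k n \<alpha> = \<lfloor>real (Suc n) * \<alpha>\<rfloor>" for n \<alpha>
  define a where "a n \<alpha> = real_of_int (k n \<alpha>) / real (Suc n)" for n \<alpha>
  have X_Fc: "X \<omega> \<in> Fc" if "\<omega> \<in> space N" for \<omega>
    using X that by (simp add: fuzzy_rv_def)
  have fixed: "(\<lambda>p. supp_fun (X (fst p)) (v, \<beta>)) \<in> borel_measurable ?P" if "\<beta> \<in> {0..1}" for v \<beta>
  proof -
    have "(\<lambda>\<omega>. level (X \<omega>) \<beta>) \<in> N \<rightarrow>\<^sub>M Kc_borel" using X that by (auto simp: fuzzy_rv_def)
    from measurable_compose[OF measurable_compose[OF measurable_fst this] measurable_support]
    show ?thesis by (simp add: supp_fun_eq_support)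
  qed
  have k_range: "k n \<alpha> \<in> {0..int (Suc n)}" if "\<alpha> \<in> {0..1}" for n \<alpha>
  proof -
    have "real (Suc n) * \<alpha> \<le> real (Suc n)" using that by (simp add: mult_left_le)
    then have "k n \<alpha> \<le> int (Suc n)" unfolding k_def by linarith
    then show ?thesis using that by (simp add: k_def)
  qed
  have a_range: "a n \<alpha> \<in> {0..\<alpha>}" and a_close: "\<alpha> - a n \<alpha> \<le> 1 / real (Suc n)" if "\<alpha> \<in> {0..1}" for n \<alpha>
  proof -
    have "real_of_int (k n \<alpha>) \<le> real (Suc n) * \<alpha>" "real (Suc n) * \<alpha> \<le> real_of_int (k n \<alpha>) + 1"
      unfolding k_def by linarith+
    then have low: "0 \<le> real (Suc n) * \<alpha> - real_of_int (k n \<alpha>)"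
      and high: "real (Suc n) * \<alpha> - real_of_int (k n \<alpha>) \<le> 1" by linarith+
    have gap: "\<alpha> - a n \<alpha> = (real (Suc n) * \<alpha> - real_of_int (k n \<alpha>)) / real (Suc n)"
      by (simp add: a_def diff_divide_distrib)
    have "0 \<le> a n \<alpha>" using k_range[OF that, of n] by (simp add: a_def)
    moreover have "0 \<le> \<alpha> - a n \<alpha>" unfolding gap using low by (intro divide_nonneg_nonneg) auto
    ultimately show "a n \<alpha> \<in> {0..\<alpha>}" by simp
    show "\<alpha> - a n \<alpha> \<le> 1 / real (Suc n)"
      unfolding gap using high by (intro divide_right_mono) auto
  qed
  have a_lim: "(\<lambda>n. a n \<alpha>) \<longlonglongrightarrow> \<alpha>" if "\<alpha> \<in> {0..1}" for \<alpha>
  proof (rule tendsto_sandwich)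
    show "(\<lambda>n. \<alpha> - 1 / real (Suc n)) \<longlonglongrightarrow> \<alpha>" by real_asymp
    show "\<forall>\<^sub>F n in sequentially. \<alpha> - 1 / real (Suc n) \<le> a n \<alpha>"
      using a_close[OF that] by (auto simp: algebra_simps intro!: always_eventually)
    show "\<forall>\<^sub>F n in sequentially. a n \<alpha> \<le> \<alpha>"
      using a_range[OF that] by (intro always_eventually) auto
  qed auto
  define G where "G n p = supp_fun (X (fst p)) (F n (fst (snd p)), a n (snd (snd p)))"
    for n and p :: "'w \<times> (real ^ 'p) \<times> real"
  have G: "G n \<in> borel_measurable ?P" for n
  proof -
    \<comment> \<open>Outside the unit interval the levels need not depend measurably on \<open>\<omega>\<close>, hence the guard on \<open>i\<close>.\<close>
    define f where "f v i p = (if i \<in> {0..int (Suc n)} then supp_fun (X (fst p)) (v, real_of_int i / real (Suc n)) else 0)"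
      for v i and p :: "'w \<times> (real ^ 'p) \<times> real"
    have f: "f v i \<in> borel_measurable ?P" for v i
    proof (cases "i \<in> {0..int (Suc n)}")
      case True
      then have "real_of_int i / real (Suc n) \<in> {0..1}" by (auto simp: field_simps)
      then show ?thesis using fixed True by (simp add: f_def[abs_def])
    next
      case False
      then have "f v i = (\<lambda>_. 0)" unfolding f_def by (intro ext) (simp only: if_False)
      then show ?thesis by simp
    qed
    have "(\<lambda>p. k n (snd (snd p))) \<in> ?P \<rightarrow>\<^sub>M count_space UNIV"
      unfolding k_def
      by (intro measurable_compose[OF _ measurable_real_floor] borel_measurable_times borel_measurable_const
          measurable_compose[OF measurable_snd measurable_snd_sphere_level])
    then have fk: "(\<lambda>p. f v (k n (snd (snd p))) p) \<in> borel_measurable ?P" for v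
      using f by (rule measurable_compose_countable[rotated])
    have fin: "finite (F n ` space sphere_measure)" using F by (simp add: simple_function_def)
    then have "F n \<in> sphere_measure \<rightarrow>\<^sub>M count_space (F n ` space sphere_measure)"
      using F[of n] unfolding measurable_count_space_eq2[OF fin] by (auto simp: simple_function_def)
    then have "(\<lambda>p. F n (fst (snd p))) \<in> ?P \<rightarrow>\<^sub>M count_space (F n ` space sphere_measure)"
      using measurable_compose[OF measurable_snd measurable_fst_sphere_level] by (rule measurable_compose[rotated])
    then have "(\<lambda>p. f (F n (fst (snd p))) (k n (snd (snd p))) p) \<in> borel_measurable ?P"
      using fin by (intro measurable_compose_countable'[OF fk]) (auto intro: countable_finite)
    then show ?thesis
      by (rule measurable_cong[THEN iffD1, rotated])
        (use k_range in \<open>auto simp: space_pair_measure space_sphere_level f_def G_def a_def\<close>)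
  qed
  show ?thesis
  proof (rule borel_measurable_LIMSEQ_real[OF _ G])
    fix p assume "p \<in> space ?P"
    then obtain \<omega> u \<alpha> where p: "p = (\<omega>, u, \<alpha>)" and \<omega>: "\<omega> \<in> space N" and u: "u \<in> sphere 0 1"
      and \<alpha>: "\<alpha> \<in> {0..1}"
      by (auto simp: space_pair_measure space_sphere_level)
    have "(\<lambda>n. norm (F n u - u) * set_norm (level (X \<omega>) 0)) \<longlonglongrightarrow> norm (u - u) * set_norm (level (X \<omega>) 0)"
      by (intro tendsto_intros F_lim u)
    then have lim0: "(\<lambda>n. norm (F n u - u) * set_norm (level (X \<omega>) 0)) \<longlonglongrightarrow> 0" by simp
    have "(\<lambda>n. supp_fun (X \<omega>) (F n u, a n \<alpha>) - supp_fun (X \<omega>) (u, a n \<alpha>)) \<longlonglongrightarrow> 0"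
    proof (rule Lim_null_comparison[OF _ lim0], intro always_eventually allI)
      fix n
      show "norm (supp_fun (X \<omega>) (F n u, a n \<alpha>) - supp_fun (X \<omega>) (u, a n \<alpha>))
          \<le> norm (F n u - u) * set_norm (level (X \<omega>) 0)"
        using supp_fun_Lipschitz[OF X_Fc[OF \<omega>], of "a n \<alpha>"] a_range[OF \<alpha>, of n] \<alpha> by auto
    qed
    moreover have "(\<lambda>n. supp_fun (X \<omega>) (u, a n \<alpha>)) \<longlonglongrightarrow> supp_fun (X \<omega>) (u, \<alpha>)"
      by (rule supp_fun_left_continuous[OF X_Fc[OF \<omega>] \<alpha> a_range[OF \<alpha>] a_lim[OF \<alpha>]])
    ultimately have "(\<lambda>n. (supp_fun (X \<omega>) (F n u, a n \<alpha>) - supp_fun (X \<omega>) (u, a n \<alpha>)) + supp_fun (X \<omega>) (u, a n \<alpha>))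
        \<longlonglongrightarrow> 0 + supp_fun (X \<omega>) (u, \<alpha>)"
      by (rule tendsto_add)
    then show "(\<lambda>n. G n p) \<longlonglongrightarrow> (case p of (\<omega>, z) \<Rightarrow> supp_fun (X \<omega>) z)"
      by (simp add: p G_def)
  qed
qed

text \<open>Mid and spread compare a point of the sphere with its antipode. The antipodal map preserves the uniform
  distribution, so an identity between support functions that holds almost everywhere passes to mids and
  spreads.\<close>

definition reflect :: "(real ^ 'p::finite) \<times> real \<Rightarrow> (real ^ 'p) \<times> real" where
  "reflect = (\<lambda>(u, \<alpha>). (- u, \<alpha>))"

lemma measurable_uminus_sphere: "uminus \<in> sphere_measure \<rightarrow>\<^sub>M (sphere_measure :: (real ^ 'p::finite) measure)"
  unfolding measurable_cong_sets[OF sets_sphere_measure sets_sphere_measure]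
  by (rule measurable_restrict_space3) auto

lemma measurable_reflect:
  "reflect \<in> sphere_level_measure \<rightarrow>\<^sub>M (sphere_level_measure :: ((real ^ 'p::finite) \<times> real) measure)"
  unfolding sphere_level_measure_def reflect_def case_prod_beta
  by (intro measurable_Pair measurable_compose[OF measurable_fst measurable_uminus_sphere] measurable_snd)

lemma distr_reflect:
  "distr sphere_level_measure sphere_level_measure reflect = (sphere_level_measure :: ((real ^ 'p::finite) \<times> real) measure)"
proof -
  let ?S = "sphere_measure :: (real ^ 'p) measure" and ?L = "restrict_space lborel {0..1::real}"
  interpret L: prob_space ?L by (rule prob_space_restrict_space) auto
  have L: "distr ?L ?L (\<lambda>x. x) = ?L" by (rule distr_id2) simp
  have "orthogonal_transformation (uminus :: real ^ 'p \<Rightarrow> _)"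
    by (simp add: orthogonal_transformation_neg)
  then have S: "distr ?S ?S uminus = ?S" by (rule sphere_measure_rotation_invariant)
  have "distr ?S ?S uminus \<Otimes>\<^sub>M distr ?L ?L (\<lambda>x. x)
      = distr (?S \<Otimes>\<^sub>M ?L) (?S \<Otimes>\<^sub>M ?L) (\<lambda>(x, y). (- x, y))"
    using L.sigma_finite_measure_axioms by (intro pair_measure_distr measurable_uminus_sphere) (auto simp: L)
  then show ?thesis unfolding S L reflect_def sphere_level_measure_def by simp
qed

lemma AE_reflect:
  fixes P :: "(real ^ 'p::finite) \<times> real \<Rightarrow> bool"
  assumes "AE z in sphere_level_measure. P z"
  shows "AE z in sphere_level_measure. P (reflect z)"
proof -
  have "AE z in distr (sphere_level_measure :: ((real ^ 'p) \<times> real) measure) sphere_level_measure reflect. P z"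
    unfolding distr_reflect by (rule assms)
  then show ?thesis by (rule AE_distrD[OF measurable_reflect])
qed

lemma mid_eq: "mid s z = (s z - s (reflect z)) / 2"
  and spr_eq: "spr s z = (s z + s (reflect z)) / 2"
  by (auto simp: mid_def spr_def reflect_def split: prod.splits)

lemma reflect_in_space: "z \<in> space sphere_level_measure \<Longrightarrow> reflect z \<in> space sphere_level_measure"
  by (rule measurable_space[OF measurable_reflect])

lemma measurable_mid_spr_joint:
  fixes X :: "'w \<Rightarrow> 'p::finite fuzzy"
  assumes X: "fuzzy_rv N X"
  shows "(\<lambda>(\<omega>, z). mid (supp_fun (X \<omega>)) z) \<in> borel_measurable (N \<Otimes>\<^sub>M sphere_level_measure)"
    and "(\<lambda>(\<omega>, z). spr (supp_fun (X \<omega>)) z) \<in> borel_measurable (N \<Otimes>\<^sub>M sphere_level_measure)"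
proof -
  let ?P = "N \<Otimes>\<^sub>M (sphere_level_measure :: ((real ^ 'p) \<times> real) measure)"
  have 1: "(\<lambda>p. supp_fun (X (fst p)) (snd p)) \<in> borel_measurable ?P"
    using measurable_supp_fun_joint[OF X] by (simp add: case_prod_beta)
  have "(\<lambda>p. (fst p, reflect (snd p))) \<in> ?P \<rightarrow>\<^sub>M ?P"
    by (intro measurable_Pair measurable_fst measurable_compose[OF measurable_snd measurable_reflect])
  from measurable_compose[OF this 1]
  have 2: "(\<lambda>p. supp_fun (X (fst p)) (reflect (snd p))) \<in> borel_measurable ?P" by simp
  show "(\<lambda>(\<omega>, z). mid (supp_fun (X \<omega>)) z) \<in> borel_measurable ?P"
    unfolding mid_eq case_prod_beta using 1 2 by measurable
  show "(\<lambda>(\<omega>, z). spr (supp_fun (X \<omega>)) z) \<in> borel_measurable ?P"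
    unfolding spr_eq case_prod_beta using 1 2 by measurable
qed

text \<open>Through constant random variables, measurability of a single support function is a case of the
  joint statement.\<close>

lemma fuzzy_rv_const:
  assumes "A \<in> Fc"
  shows "fuzzy_rv N (\<lambda>_. A)"
  using assms level_Kc[OF assms] by (auto simp: fuzzy_rv_def space_Kc_borel intro!: measurable_const)

lemma measurable_supp_fun:
  fixes A :: "'p::finite fuzzy"
  assumes A: "A \<in> Fc"
  shows "supp_fun A \<in> borel_measurable sphere_level_measure"
    and "mid (supp_fun A) \<in> borel_measurable sphere_level_measure"
    and "spr (supp_fun A) \<in> borel_measurable sphere_level_measure"
proof -
  have X: "fuzzy_rv (count_space (UNIV :: unit set)) (\<lambda>_. A)" by (rule fuzzy_rv_const[OF A])
  show "supp_fun A \<in> borel_measurable sphere_level_measure"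
    using measurable_Pair2[OF measurable_supp_fun_joint[OF X], of "()"] by simp
  show "mid (supp_fun A) \<in> borel_measurable sphere_level_measure"
    using measurable_Pair2[OF measurable_mid_spr_joint(1)[OF X], of "()"] by simp
  show "spr (supp_fun A) \<in> borel_measurable sphere_level_measure"
    using measurable_Pair2[OF measurable_mid_spr_joint(2)[OF X], of "()"] by simp
qed

section \<open>The metrics as weighted norms\<close>

text \<open>In the equality case of the triangle inequality for \<open>f0 - f1\<close> and \<open>f1 - f2\<close>, the relation
  \<open>b (f0 - f1) = a (f1 - f2)\<close> can be solved for \<open>f1\<close>, with \<open>l = a / (a + b)\<close>. The same \<open>l\<close> serves both
  components. If \<open>a = 0\<close>, then \<open>l = 0\<close> works and avoids the division by zero that \<open>a = b = 0\<close> would cause.\<close>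

lemma pair_norm_between:
  fixes f0 f1 f2 g0 g1 g2 :: "'a \<Rightarrow> real" and N :: "'a measure" and s \<theta> :: real
  defines "d \<equiv> \<lambda>f g f' g'. pair_norm N s \<theta> (\<lambda>x. f x - f' x) (\<lambda>x. g x - g' x)"
  assumes s: "1 < s" and \<theta>: "0 \<le> \<theta>"
    and f: "powr_integrable N s (\<lambda>x. f0 x - f1 x)" "powr_integrable N s (\<lambda>x. f1 x - f2 x)"
    and g: "powr_integrable N s (\<lambda>x. g0 x - g1 x)" "powr_integrable N s (\<lambda>x. g1 x - g2 x)"
    and eq: "d f0 g0 f2 g2 = d f0 g0 f1 g1 + d f1 g1 f2 g2"
  obtains l where "0 \<le> l" "l \<le> 1" "AE x in N. f1 x = (1 - l) * f0 x + l * f2 x"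
    "0 < \<theta> \<Longrightarrow> AE x in N. g1 x = (1 - l) * g0 x + l * g2 x"
proof -
  define a where "a = d f0 g0 f1 g1"
  define b where "b = d f1 g1 f2 g2"
  have a0: "0 \<le> a" and b0: "0 \<le> b" by (auto simp: a_def b_def d_def pair_norm_nonneg)
  have eq': "pair_norm N s \<theta> (\<lambda>x. (f0 x - f1 x) + (f1 x - f2 x)) (\<lambda>x. (g0 x - g1 x) + (g1 x - g2 x))
      = pair_norm N s \<theta> (\<lambda>x. f0 x - f1 x) (\<lambda>x. g0 x - g1 x) + pair_norm N s \<theta> (\<lambda>x. f1 x - f2 x) (\<lambda>x. g1 x - g2 x)"
    using eq by (simp add: d_def)
  have f_prop: "AE x in N. b * (f0 x - f1 x) = a * (f1 x - f2 x)"
    using pair_norm_triangle_equality(1)[OF s \<theta> f g eq'] unfolding a_def b_def d_def .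
  have g_prop: "AE x in N. b * (g0 x - g1 x) = a * (g1 x - g2 x)" if "0 < \<theta>"
    using pair_norm_triangle_equality(2)[OF s \<theta> f g eq' that] unfolding a_def b_def d_def .
  show thesis
  proof (cases "a = 0")
    case True
    note null = pair_norm_eq_0D[OF \<theta> f(1) g(1)]
    have "AE x in N. f1 x = (1 - 0) * f0 x + 0 * f2 x"
      using null(1) True unfolding a_def d_def by (auto elim: eventually_mono)
    moreover have "AE x in N. g1 x = (1 - 0) * g0 x + 0 * g2 x" if "0 < \<theta>"
      using null(2) that True unfolding a_def d_def by (auto elim: eventually_mono)
    ultimately show thesis using that[of 0] by auto
  next
    case False
    then have ab: "0 < a + b" using a0 b0 by simp
    define l where "l = a / (a + b)"
    have l: "0 \<le> l" "l \<le> 1" and l1: "1 - l = b / (a + b)"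
      using a0 b0 ab by (auto simp: l_def field_simps)
    have solve: "y = (1 - l) * x + l * z" if "b * (x - y) = a * (y - z)" for x y z
    proof -
      have "(a + b) * y = b * x + a * z" using that by (simp add: algebra_simps)
      then have "y = (b * x + a * z) / (a + b)" using ab by (simp add: field_simps)
      then show ?thesis by (simp add: l1) (simp add: l_def add_divide_distrib)
    qed
    show thesis
      by (rule that[OF l eventually_mono[OF f_prop solve] eventually_mono[OF g_prop solve]])
  qed
qed

lemma powr_integrable_bounded:
  assumes N: "prob_space N" and f: "f \<in> borel_measurable N" and s: "0 \<le> s"
    and le: "\<And>x. x \<in> space N \<Longrightarrow> \<bar>f x\<bar> \<le> c"
  shows "powr_integrable N s f" and "(LINT x|N. \<bar>f x\<bar> powr s) \<le> c powr s"
proof -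
  interpret prob_space N by (rule N)
  have le': "\<bar>f x\<bar> powr s \<le> c powr s" if "x \<in> space N" for x
    using le[OF that] s by (intro powr_mono2) auto
  have int: "integrable N (\<lambda>x. \<bar>f x\<bar> powr s)"
    using f le' by (intro integrable_const_bound[of _ "c powr s"]) (auto intro: AE_I2)
  then show "powr_integrable N s f" using f by (simp add: powr_integrable_def)
  have "(LINT x|N. \<bar>f x\<bar> powr s) \<le> (LINT x|N. c powr s)"
    using int le' by (intro integral_mono) auto
  then show "(LINT x|N. \<bar>f x\<bar> powr s) \<le> c powr s" by (simp add: prob_space)
qed

lemma abs_supp_fun_le_on_space:
  fixes A :: "'p::finite fuzzy"
  assumes A: "A \<in> Fc" and z: "z \<in> space sphere_level_measure"
  shows "\<bar>supp_fun A z\<bar> \<le> set_norm (level A 0)"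
  using z abs_supp_fun_le[OF A] by (auto simp: space_sphere_level)

lemma supp_fun_diff_bounds:
  fixes A B :: "'p::finite fuzzy"
  assumes A: "A \<in> Fc" and B: "B \<in> Fc" and z: "z \<in> space sphere_level_measure"
  defines "c \<equiv> set_norm (level A 0) + set_norm (level B 0)"
  shows "\<bar>supp_fun A z - supp_fun B z\<bar> \<le> c"
    and "\<bar>mid (supp_fun A) z - mid (supp_fun B) z\<bar> \<le> c"
    and "\<bar>spr (supp_fun A) z - spr (supp_fun B) z\<bar> \<le> c"
proof -
  note bound = abs_supp_fun_le_on_space
  show "\<bar>supp_fun A z - supp_fun B z\<bar> \<le> c"
    and "\<bar>mid (supp_fun A) z - mid (supp_fun B) z\<bar> \<le> c"
    and "\<bar>spr (supp_fun A) z - spr (supp_fun B) z\<bar> \<le> c"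
    using bound[OF A z] bound[OF B z] bound[OF A reflect_in_space[OF z]] bound[OF B reflect_in_space[OF z]]
    unfolding c_def mid_eq spr_eq by (auto simp: abs_le_iff field_simps)
qed

lemma supp_fun_diff_powr_integrable:
  fixes A B :: "'p::finite fuzzy"
  assumes A: "A \<in> Fc" and B: "B \<in> Fc" and s: "0 \<le> s"
  shows "powr_integrable sphere_level_measure s (\<lambda>z. supp_fun A z - supp_fun B z)"
    and "powr_integrable sphere_level_measure s (\<lambda>z. mid (supp_fun A) z - mid (supp_fun B) z)"
    and "powr_integrable sphere_level_measure s (\<lambda>z. spr (supp_fun A) z - spr (supp_fun B) z)"
  using measurable_supp_fun[OF A] measurable_supp_fun[OF B] supp_fun_diff_bounds[OF A B] s
  by (auto intro!: powr_integrable_bounded(1)[OF prob_space_sphere_level])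

lemma Lr_norm_powr:
  assumes "1 \<le> s"
  shows "Lr_norm s f powr s = (LINT z|sphere_level_measure. \<bar>f z\<bar> powr s)"
proof -
  have "0 \<le> (LINT z|sphere_level_measure. \<bar>f z\<bar> powr s)" by simp
  then show ?thesis using assms by (simp add: Lr_norm_def powr_powr)
qed

text \<open>The second component is written \<open>0 - 0\<close> to match the differences in \<open>pair_norm_between\<close>.\<close>

lemma rho_eq_pair_norm:
  "rho s A B = pair_norm sphere_level_measure s 0 (\<lambda>z. supp_fun A z - supp_fun B z) (\<lambda>z. 0 - 0)"
  by (simp add: rho_def Lr_norm_def pair_norm_def pair_mass_def)

lemma dist_mid_spr_eq_pair_norm:
  assumes "1 \<le> s"
  shows "dist_mid_spr s \<theta> A B = pair_norm sphere_level_measure s \<theta>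
    (\<lambda>z. mid (supp_fun A) z - mid (supp_fun B) z) (\<lambda>z. spr (supp_fun A) z - spr (supp_fun B) z)"
  unfolding dist_mid_spr_def Lr_norm_powr[OF assms] by (simp add: pair_norm_def pair_mass_def)

lemma dist_mid_spr_nonneg: "0 \<le> dist_mid_spr s \<theta> A B"
  by (simp add: dist_mid_spr_def)

lemma dist_mid_spr_commute:
  assumes s: "1 \<le> s" and \<theta>: "0 \<le> \<theta>"
  shows "dist_mid_spr s \<theta> A B = dist_mid_spr s \<theta> B A"
  unfolding dist_mid_spr_eq_pair_norm[OF s]
  by (simp add: pair_norm_def pair_mass_def abs_minus_commute)

lemma dist_mid_spr_triangle:
  fixes A B C :: "'p::finite fuzzy"
  assumes s: "1 \<le> s" and \<theta>: "0 \<le> \<theta>" and Fc: "A \<in> Fc" "B \<in> Fc" "C \<in> Fc"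
  shows "dist_mid_spr s \<theta> A C \<le> dist_mid_spr s \<theta> A B + dist_mid_spr s \<theta> B C"
proof -
  have s0: "0 \<le> s" using s by simp
  show ?thesis
    unfolding dist_mid_spr_eq_pair_norm[OF s]
    using pair_norm_triangle[OF s \<theta> supp_fun_diff_powr_integrable(2)[OF Fc(1,2) s0] supp_fun_diff_powr_integrable(2)[OF Fc(2,3) s0]
        supp_fun_diff_powr_integrable(3)[OF Fc(1,2) s0] supp_fun_diff_powr_integrable(3)[OF Fc(2,3) s0]]
    by simp
qed

text \<open>A fuzzy set enters the distances only through the mid and the spread of its support function up to null
  sets, so this is the notion of betweenness along which expected distances are convex. Unlike an identity
  between fuzzy sets, it can be read off directly from an equality of norms.\<close>

definition ae_between :: "real \<Rightarrow> 'p::finite fuzzy \<Rightarrow> 'p fuzzy \<Rightarrow> 'p fuzzy \<Rightarrow> bool" where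
  "ae_between l A B C \<longleftrightarrow>
    (AE z in sphere_level_measure. mid (supp_fun C) z = (1 - l) * mid (supp_fun A) z + l * mid (supp_fun B) z) \<and>
    (AE z in sphere_level_measure. spr (supp_fun C) z = (1 - l) * spr (supp_fun A) z + l * spr (supp_fun B) z)"

lemma ae_betweenI:
  assumes "AE z in sphere_level_measure. supp_fun C z = (1 - l) * supp_fun A z + l * supp_fun B z"
  shows "ae_between l A B C"
  using assms AE_reflect[OF assms] unfolding ae_between_def mid_eq spr_eq
  by (auto elim: eventually_elim2 simp: field_simps)

lemma dist_mid_spr_convex:
  fixes A B C X :: "'p::finite fuzzy"
  assumes s: "1 \<le> s" and \<theta>: "0 \<le> \<theta>" and l: "0 \<le> l" "l \<le> 1"
    and Fc: "A \<in> Fc" "B \<in> Fc" "C \<in> Fc" "X \<in> Fc" and between: "ae_between l A B C"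
  shows "dist_mid_spr s \<theta> C X \<le> (1 - l) * dist_mid_spr s \<theta> A X + l * dist_mid_spr s \<theta> B X"
proof -
  let ?\<mu> = "sphere_level_measure :: ((real ^ 'p) \<times> real) measure"
  let ?m = "\<lambda>A z. mid (supp_fun A) z - mid (supp_fun X) z" and ?p = "\<lambda>A z. spr (supp_fun A) z - spr (supp_fun X) z"
  have s0: "0 \<le> s" using s by simp
  note int = supp_fun_diff_powr_integrable(2,3)[OF _ Fc(4) s0]
  have meas: "(\<lambda>z. ?m D z) \<in> borel_measurable ?\<mu>" "(\<lambda>z. ?p D z) \<in> borel_measurable ?\<mu>" if "D \<in> Fc" for D
    using int[OF that] by (auto simp: powr_integrable_def)
  have "dist_mid_spr s \<theta> C X = pair_norm ?\<mu> s \<theta> (\<lambda>z. (1 - l) * ?m A z + l * ?m B z) (\<lambda>z. (1 - l) * ?p A z + l * ?p B z)"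
    unfolding dist_mid_spr_eq_pair_norm[OF s]
  proof (rule pair_norm_cong_AE)
    show "AE z in ?\<mu>. ?m C z = (1 - l) * ?m A z + l * ?m B z"
      using between unfolding ae_between_def by (auto elim!: eventually_mono simp: algebra_simps)
    show "AE z in ?\<mu>. ?p C z = (1 - l) * ?p A z + l * ?p B z"
      using between unfolding ae_between_def by (auto elim!: eventually_mono simp: algebra_simps)
  qed (intro borel_measurable_add borel_measurable_times borel_measurable_const meas Fc)+
  also have "\<dots> \<le> pair_norm ?\<mu> s \<theta> (\<lambda>z. (1 - l) * ?m A z) (\<lambda>z. (1 - l) * ?p A z)
      + pair_norm ?\<mu> s \<theta> (\<lambda>z. l * ?m B z) (\<lambda>z. l * ?p B z)"
    by (intro pair_norm_triangle s \<theta> powr_integrable_cmult int Fc)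
  also have "\<dots> = (1 - l) * dist_mid_spr s \<theta> A X + l * dist_mid_spr s \<theta> B X"
    unfolding pair_norm_scale[OF s \<theta>] dist_mid_spr_eq_pair_norm[OF s] using l by simp
  finally show ?thesis .
qed

text \<open>For \<open>\<rho>\<^sub>s\<close> the equality case gives an identity of support functions, which reflection transfers to mids and
  spreads; for the other metric it gives the identities of mids and spreads directly, and \<open>\<theta> > 0\<close> is
  what makes the spreads visible to the metric.\<close>

lemma ae_between_if_metric_between:
  fixes A U V :: "'p::finite fuzzy"
  assumes s: "1 < s" and \<theta>: "0 < \<theta>" and d: "d \<in> {rho s, dist_mid_spr s \<theta>}"
    and Fc: "A \<in> Fc" "U \<in> Fc" "V \<in> Fc" and eq: "d A V = d A U + d U V"
  obtains l where "0 \<le> l" "l \<le> 1" "ae_between l A V U"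
proof -
  have s1: "1 \<le> s" and s0: "0 \<le> s" using s by auto
  note int = supp_fun_diff_powr_integrable[OF _ _ s0]
  show thesis
  proof (cases "d = rho s")
    case True
    have zero: "powr_integrable (sphere_level_measure :: ((real ^ 'p) \<times> real) measure) s (\<lambda>z. 0 - 0)"
      using s by (simp add: powr_integrable_def)
    show thesis
      by (rule pair_norm_between[OF s order_refl int(1)[OF Fc(1,2)] int(1)[OF Fc(2,3)] zero zero])
        (use eq that in \<open>auto simp: True rho_eq_pair_norm intro: ae_betweenI\<close>)
  next
    case False
    then have d: "d = dist_mid_spr s \<theta>" using d by auto
    show thesis
      by (rule pair_norm_between[OF s less_imp_le[OF \<theta>] int(2)[OF Fc(1,2)] int(2)[OF Fc(2,3)]
            int(3)[OF Fc(1,2)] int(3)[OF Fc(2,3)]])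
        (use eq that \<theta> in \<open>auto simp: d dist_mid_spr_eq_pair_norm[OF s1] ae_between_def\<close>)
  qed
qed

lemma ae_between_fuzzy_convex_combination:
  fixes A U :: "'p::finite fuzzy"
  assumes "A \<in> Fc" "U \<in> Fc" "0 \<le> l" "l \<le> 1"
  shows "ae_between l A U (fuzzy_add (fuzzy_scale (1 - l) A) (fuzzy_scale l U))"
proof (rule ae_betweenI, rule AE_I2)
  fix z :: "(real ^ 'p) \<times> real" assume "z \<in> space sphere_level_measure"
  then obtain u \<alpha> where "z = (u, \<alpha>)" "\<alpha> \<in> {0..1}" by (auto simp: space_sphere_level)
  then show "supp_fun (fuzzy_add (fuzzy_scale (1 - l) A) (fuzzy_scale l U)) z
      = (1 - l) * supp_fun A z + l * supp_fun U z"
    using assms by (simp add: supp_fun_add supp_fun_scale fuzzy_scale_Fc del: atLeastAtMost_iff)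
qed

text \<open>The measure has total mass 1 and both components are bounded by \<open>\<parallel>A\<^sub>0\<parallel> + \<parallel>B\<^sub>0\<parallel>\<close>.\<close>

lemma dist_mid_spr_le:
  fixes A B :: "'p::finite fuzzy"
  assumes s: "1 \<le> s" and \<theta>: "0 \<le> \<theta>" and A: "A \<in> Fc" and B: "B \<in> Fc"
  shows "dist_mid_spr s \<theta> A B \<le> (1 + \<theta>) powr (1 / s) * (set_norm (level A 0) + set_norm (level B 0))"
proof -
  let ?\<mu> = "sphere_level_measure :: ((real ^ 'p) \<times> real) measure"
  let ?m = "\<lambda>z. mid (supp_fun A) z - mid (supp_fun B) z" and ?p = "\<lambda>z. spr (supp_fun A) z - spr (supp_fun B) z"
  define c where "c = set_norm (level A 0) + set_norm (level B 0)"
  have c: "0 \<le> c" using set_norm_nonneg[OF A] set_norm_nonneg[OF B] by (simp add: c_def)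
  have s0: "0 \<le> s" using s by simp
  have m: "?m \<in> borel_measurable ?\<mu>" and p: "?p \<in> borel_measurable ?\<mu>"
    using supp_fun_diff_powr_integrable(2,3)[OF A B s0] by (auto simp: powr_integrable_def)
  have "(LINT z|?\<mu>. \<bar>?m z\<bar> powr s) \<le> c powr s" "(LINT z|?\<mu>. \<bar>?p z\<bar> powr s) \<le> c powr s"
    unfolding c_def
    using supp_fun_diff_bounds[OF A B] s0 by (auto intro!: powr_integrable_bounded(2)[OF prob_space_sphere_level] m p)
  then have "pair_mass ?\<mu> s \<theta> ?m ?p \<le> c powr s + \<theta> * c powr s"
    unfolding pair_mass_def using \<theta> by (intro add_mono mult_left_mono)
  also have "\<dots> = (1 + \<theta>) * c powr s" by (simp add: algebra_simps)
  finally have "dist_mid_spr s \<theta> A B \<le> ((1 + \<theta>) * c powr s) powr (1 / s)"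
    unfolding dist_mid_spr_eq_pair_norm[OF s] pair_norm_def
    using pair_mass_nonneg[OF \<theta>] s by (intro powr_mono2) auto
  also have "\<dots> = (1 + \<theta>) powr (1 / s) * c" using c \<theta> s by (simp add: powr_mult powr_powr)
  finally show ?thesis by (simp add: c_def)
qed

section \<open>Expected distances\<close>

lemma measurable_dist_mid_spr:
  fixes X :: "'w \<Rightarrow> 'p::finite fuzzy"
  assumes s: "1 \<le> s" and A: "A \<in> Fc" and X: "fuzzy_rv M X"
  shows "(\<lambda>\<omega>. dist_mid_spr s \<theta> A (X \<omega>)) \<in> borel_measurable M"
proof -
  let ?\<mu> = "sphere_level_measure :: ((real ^ 'p) \<times> real) measure"
  interpret prob_space ?\<mu> by (rule prob_space_sphere_level)
  have 1: "(\<lambda>p. mid (supp_fun (X (fst p))) (snd p)) \<in> borel_measurable (M \<Otimes>\<^sub>M ?\<mu>)"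
    and 2: "(\<lambda>p. spr (supp_fun (X (fst p))) (snd p)) \<in> borel_measurable (M \<Otimes>\<^sub>M ?\<mu>)"
    using measurable_mid_spr_joint[OF X] by (auto simp: case_prod_beta)
  have 3: "(\<lambda>p. mid (supp_fun A) (snd p)) \<in> borel_measurable (M \<Otimes>\<^sub>M ?\<mu>)"
    and 4: "(\<lambda>p. spr (supp_fun A) (snd p)) \<in> borel_measurable (M \<Otimes>\<^sub>M ?\<mu>)"
    using measurable_supp_fun[OF A] by (auto intro: measurable_compose[OF measurable_snd])
  have "(\<lambda>\<omega>. LINT z|?\<mu>. \<bar>mid (supp_fun A) z - mid (supp_fun (X \<omega>)) z\<bar> powr s) \<in> borel_measurable M"
    by (rule borel_measurable_lebesgue_integral) (use 1 3 in \<open>simp add: case_prod_beta\<close>)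
  moreover have "(\<lambda>\<omega>. LINT z|?\<mu>. \<bar>spr (supp_fun A) z - spr (supp_fun (X \<omega>)) z\<bar> powr s) \<in> borel_measurable M"
    by (rule borel_measurable_lebesgue_integral) (use 2 4 in \<open>simp add: case_prod_beta\<close>)
  ultimately show ?thesis
    unfolding dist_mid_spr_eq_pair_norm[OF s] pair_norm_def pair_mass_def by measurable
qed

lemma integrable_dist_mid_spr_powr:
  fixes X :: "'w \<Rightarrow> 'p::finite fuzzy"
  assumes M: "prob_space M" and s: "1 \<le> s" and \<theta>: "0 \<le> \<theta>" and e: "1 \<le> e"
    and A: "A \<in> Fc" and X: "X \<in> Lr_fuzzy M e"
  shows "integrable M (\<lambda>\<omega>. dist_mid_spr s \<theta> A (X \<omega>) powr e)"
proof -
  interpret prob_space M by (rule M)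
  have rv: "fuzzy_rv M X" and int: "integrable M (\<lambda>\<omega>. set_norm (level (X \<omega>) 0) powr e)"
    using X by (auto simp: Lr_fuzzy_def)
  have X_Fc: "X \<omega> \<in> Fc" if "\<omega> \<in> space M" for \<omega> using rv that by (simp add: fuzzy_rv_def)
  define a where "a = set_norm (level A 0)"
  define x where "x \<omega> = set_norm (level (X \<omega>) 0)" for \<omega>
  define K where "K = (1 + \<theta>) powr (1 / s)"
  have a: "0 \<le> a" unfolding a_def by (rule set_norm_nonneg[OF A])
  have K: "0 \<le> K" by (simp add: K_def)
  show ?thesis
  proof (rule Bochner_Integration.integrable_bound)
    show "integrable M (\<lambda>\<omega>. K powr e * split_bound e 1 1 (a powr e) (x \<omega> powr e))"
      unfolding split_bound_def using int by (auto simp: x_def)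
    show "(\<lambda>\<omega>. dist_mid_spr s \<theta> A (X \<omega>) powr e) \<in> borel_measurable M"
      using measurable_dist_mid_spr[OF s A rv] by measurable
    show "AE \<omega> in M. norm (dist_mid_spr s \<theta> A (X \<omega>) powr e) \<le> norm (K powr e * split_bound e 1 1 (a powr e) (x \<omega> powr e))"
    proof (rule AE_I2)
      fix \<omega> assume \<omega>: "\<omega> \<in> space M"
      have x: "0 \<le> x \<omega>" unfolding x_def by (rule set_norm_nonneg[OF X_Fc[OF \<omega>]])
      have "dist_mid_spr s \<theta> A (X \<omega>) \<le> K * (a + x \<omega>)"
        unfolding K_def a_def x_def by (rule dist_mid_spr_le[OF s \<theta> A X_Fc[OF \<omega>]])
      then have "dist_mid_spr s \<theta> A (X \<omega>) powr e \<le> (K * (a + x \<omega>)) powr e"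
        using e dist_mid_spr_nonneg by (intro powr_mono2) auto
      also have "\<dots> = K powr e * \<bar>a + x \<omega>\<bar> powr e" using K a x by (simp add: powr_mult)
      also have "\<dots> \<le> K powr e * split_bound e 1 1 (a powr e) (x \<omega> powr e)"
        using abs_add_powr_le_split_bound(1)[OF e, of 1 1 a "x \<omega>"] a x by (intro mult_left_mono) auto
      finally show "norm (dist_mid_spr s \<theta> A (X \<omega>) powr e) \<le> norm (K powr e * split_bound e 1 1 (a powr e) (x \<omega> powr e))"
        unfolding real_norm_def using powr_ge_zero[of "dist_mid_spr s \<theta> A (X \<omega>)" e] by linarith
    qed
  qed
qed

text \<open>The exponents \<open>e = 1\<close> and \<open>e = r\<close> correspond to the location depth and to the raised depth.\<close>

definition cost :: "'w measure \<Rightarrow> real \<Rightarrow> real \<Rightarrow> real \<Rightarrow> ('w \<Rightarrow> 'p::finite fuzzy) \<Rightarrow> 'p fuzzy \<Rightarrow> real" where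
  "cost M r \<theta> e X A = (LINT \<omega>|M. dist_mid_spr r \<theta> A (X \<omega>) powr e)"

lemma cost_nonneg: "0 \<le> cost M r \<theta> e X A"
  by (simp add: cost_def)

lemma location_depth_eq_cost: "location_depth M r \<theta> A X = inverse (1 + cost M r \<theta> 1 X A)"
  by (simp add: location_depth_def cost_def dist_mid_spr_nonneg)

lemma location_raised_depth_eq_cost: "location_raised_depth M r \<theta> A X = inverse (1 + cost M r \<theta> r X A)"
  by (simp add: location_raised_depth_def cost_def)

text \<open>The expected power of the distance is convex along segments, and a convex function whose value at the start of a segment
  does not exceed its value at the end is, throughout the segment, at most the value at the end.\<close>

lemma cost_between_le:
  fixes X :: "'w \<Rightarrow> 'p::finite fuzzy"
  assumes M: "prob_space M" and r: "1 \<le> r" and \<theta>: "0 \<le> \<theta>" and e: "1 \<le> e" and X: "X \<in> Lr_fuzzy M e"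
    and Fc: "A \<in> Fc" "B \<in> Fc" "C \<in> Fc" and l: "0 \<le> l" "l \<le> 1" and between: "ae_between l A B C"
    and min: "cost M r \<theta> e X A \<le> cost M r \<theta> e X B"
  shows "cost M r \<theta> e X C \<le> cost M r \<theta> e X B"
proof -
  note int = integrable_dist_mid_spr_powr[OF M r \<theta> e _ X]
  have X_Fc: "X \<omega> \<in> Fc" if "\<omega> \<in> space M" for \<omega>
    using X that by (simp add: Lr_fuzzy_def fuzzy_rv_def)
  let ?d = "\<lambda>D \<omega>. dist_mid_spr r \<theta> D (X \<omega>)"
  have convex: "?d C \<omega> powr e \<le> (1 - l) * ?d A \<omega> powr e + l * ?d B \<omega> powr e" if "\<omega> \<in> space M" for \<omega>
  proof -
    have d: "?d C \<omega> \<le> (1 - l) * ?d A \<omega> + l * ?d B \<omega>"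
      by (rule dist_mid_spr_convex[OF r \<theta> l Fc X_Fc[OF that] between])
    have nn: "0 \<le> ?d D \<omega>" for D by (rule dist_mid_spr_nonneg)
    have "?d C \<omega> powr e \<le> ((1 - l) * ?d A \<omega> + l * ?d B \<omega>) powr e"
      using d nn e by (intro powr_mono2) auto
    also have "\<dots> \<le> (1 - l) * ?d A \<omega> powr e + l * ?d B \<omega> powr e"
    proof (cases "l = 0 \<or> l = 1")
      case False
      then have "0 < l" "l < 1" using l by auto
      then show ?thesis using abs_powr_convex(1)[OF e, of l "?d A \<omega>" "?d B \<omega>"] nn l by simp
    qed (use nn in auto)
    finally show ?thesis .
  qed
  have "cost M r \<theta> e X C \<le> (LINT \<omega>|M. (1 - l) * ?d A \<omega> powr e + l * ?d B \<omega> powr e)"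
    unfolding cost_def using convex int Fc by (intro integral_mono) auto
  also have "\<dots> = (1 - l) * cost M r \<theta> e X A + l * cost M r \<theta> e X B"
    unfolding cost_def using int Fc by simp
  also have "\<dots> \<le> (1 - l) * cost M r \<theta> e X B + l * cost M r \<theta> e X B"
    using min l by (intro add_mono mult_left_mono) auto
  finally show ?thesis by (simp add: algebra_simps)
qed

lemma powr_ge_minus_one:
  fixes x e :: real
  assumes "0 \<le> x" "1 \<le> e"
  shows "x - 1 \<le> x powr e"
proof (cases "1 \<le> x")
  case True
  then have "x powr 1 \<le> x powr e" using assms by (intro powr_mono) auto
  then show ?thesis using True by simp
qed (use powr_ge_zero[of x e] in linarith)

text \<open>The crude bounds \<open>x - 1 \<le> x\<^sup>e\<close> for the two distances to \<open>X\<close> account for the constant 2; they avoid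
  separating the cases \<open>e = 1\<close> and \<open>e = r\<close>.\<close>

lemma cost_ge:
  fixes X :: "'w \<Rightarrow> 'p::finite fuzzy"
  assumes M: "prob_space M" and r: "1 \<le> r" and \<theta>: "0 \<le> \<theta>" and e: "1 \<le> e" and X: "X \<in> Lr_fuzzy M e"
    and Fc: "A \<in> Fc" "B \<in> Fc"
  shows "dist_mid_spr r \<theta> B A - cost M r \<theta> e X A - 2 \<le> cost M r \<theta> e X B"
proof -
  interpret prob_space M by (rule M)
  note int = integrable_dist_mid_spr_powr[OF M r \<theta> e _ X]
  have X_Fc: "X \<omega> \<in> Fc" if "\<omega> \<in> space M" for \<omega>
    using X that by (simp add: Lr_fuzzy_def fuzzy_rv_def)
  let ?d = "\<lambda>D \<omega>. dist_mid_spr r \<theta> D (X \<omega>)"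
  have "dist_mid_spr r \<theta> B A - ?d A \<omega> powr e - 2 \<le> ?d B \<omega> powr e" if "\<omega> \<in> space M" for \<omega>
  proof -
    have "dist_mid_spr r \<theta> B A \<le> ?d B \<omega> + dist_mid_spr r \<theta> (X \<omega>) A"
      by (rule dist_mid_spr_triangle[OF r \<theta> Fc(2) X_Fc[OF that] Fc(1)])
    moreover have "dist_mid_spr r \<theta> (X \<omega>) A = ?d A \<omega>" by (rule dist_mid_spr_commute[OF r \<theta>])
    moreover have "?d D \<omega> - 1 \<le> ?d D \<omega> powr e" for D
      by (rule powr_ge_minus_one[OF dist_mid_spr_nonneg e])
    note this[of A] this[of B]
    ultimately show ?thesis by linarith
  qed
  then have "(LINT \<omega>|M. dist_mid_spr r \<theta> B A - ?d A \<omega> powr e - 2) \<le> cost M r \<theta> e X B"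
    unfolding cost_def using int Fc by (intro integral_mono) auto
  moreover have "(LINT \<omega>|M. dist_mid_spr r \<theta> B A - ?d A \<omega> powr e - 2) = dist_mid_spr r \<theta> B A - cost M r \<theta> e X A - 2"
    unfolding cost_def using int Fc by (simp add: prob_space)
  ultimately show ?thesis by simp
qed

lemma depth_tendsto_0:
  fixes X :: "'w \<Rightarrow> 'p::finite fuzzy"
  assumes M: "prob_space M" and r: "1 \<le> r" and \<theta>: "0 \<le> \<theta>" and e: "1 \<le> e" and X: "X \<in> Lr_fuzzy M e"
    and A: "A \<in> Fc" and B: "eventually (\<lambda>n. B n \<in> Fc) F"
    and lim: "filterlim (\<lambda>n. dist_mid_spr r \<theta> (B n) A) at_top F"
  shows "((\<lambda>n. inverse (1 + cost M r \<theta> e X (B n))) \<longlongrightarrow> 0) F"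
proof -
  have "filterlim (\<lambda>n. (- cost M r \<theta> e X A - 1) + dist_mid_spr r \<theta> (B n) A) at_top F"
    by (rule filterlim_tendsto_add_at_top[OF tendsto_const lim])
  then have "filterlim (\<lambda>n. 1 + cost M r \<theta> e X (B n)) at_top F"
    by (rule filterlim_at_top_mono) (use B cost_ge[OF M r \<theta> e X A] in \<open>force elim: eventually_mono\<close>)
  then show ?thesis by (rule tendsto_inverse_0_at_top)
qed

section \<open>Comparison of metrics and positivity\<close>

lemma powr_le_one_plus_powr:
  fixes x s r :: real
  assumes "0 \<le> x" "0 \<le> s" "s \<le> r"
  shows "x powr s \<le> 1 + x powr r"
proof (cases "1 \<le> x")
  case True
  then show ?thesis using assms powr_mono[of s r x] by simp
next
  case False
  then have "x powr s \<le> 1 powr s" using assms by (intro powr_mono2) auto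
  then show ?thesis using powr_ge_zero[of x r] unfolding powr_one_eq_one by linarith
qed

lemma powr_integral_le:
  assumes N: "prob_space N" and s: "0 \<le> s" "s \<le> r"
    and f: "powr_integrable N s f" "powr_integrable N r f"
  shows "(LINT x|N. \<bar>f x\<bar> powr s) \<le> 1 + (LINT x|N. \<bar>f x\<bar> powr r)"
proof -
  interpret prob_space N by (rule N)
  have int: "integrable N (\<lambda>x. \<bar>f x\<bar> powr s)" "integrable N (\<lambda>x. \<bar>f x\<bar> powr r)"
    using f by (auto simp: powr_integrable_def)
  have "(LINT x|N. \<bar>f x\<bar> powr s) \<le> (LINT x|N. 1 + \<bar>f x\<bar> powr r)"
    using int s by (intro integral_mono powr_le_one_plus_powr) auto
  then show ?thesis using int by (simp add: prob_space)
qed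

text \<open>Passing from the exponent \<open>s\<close> to \<open>r\<close> costs an additive constant, since \<open>x\<^sup>s \<le> 1 + x\<^sup>r\<close> on a
  probability space. The support function is the sum of its mid and its spread, and dividing by
  \<open>\<theta>\<close> recovers the spread part from the metric. The constants are far from optimal, but only divergence
  to infinity is to be transferred.\<close>

lemma metric_powr_le_dist_mid_spr_powr:
  fixes A B :: "'p::finite fuzzy"
  assumes \<theta>: "0 < \<theta>" and s: "1 \<le> s" "s \<le> r" and d: "d \<in> {rho s, dist_mid_spr s \<theta>}"
    and A: "A \<in> Fc" and B: "B \<in> Fc"
  shows "d A B powr s \<le> (1 + \<theta>) + 2 powr r * (1 + 1 / \<theta>) * dist_mid_spr r \<theta> A B powr r"
proof -
  let ?\<mu> = "sphere_level_measure :: ((real ^ 'p) \<times> real) measure"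
  let ?h = "\<lambda>z. supp_fun A z - supp_fun B z"
  let ?m = "\<lambda>z. mid (supp_fun A) z - mid (supp_fun B) z" and ?p = "\<lambda>z. spr (supp_fun A) z - spr (supp_fun B) z"
  have r: "1 \<le> r" and s0: "0 \<le> s" and r0: "0 \<le> r" and \<theta>0: "0 \<le> \<theta>" using s \<theta> by auto
  note ints = supp_fun_diff_powr_integrable[OF A B s0] and intr = supp_fun_diff_powr_integrable[OF A B r0]
  define Im where "Im = (LINT z|?\<mu>. \<bar>?m z\<bar> powr r)"
  define Ip where "Ip = (LINT z|?\<mu>. \<bar>?p z\<bar> powr r)"
  have Im: "0 \<le> Im" and Ip: "0 \<le> Ip" by (auto simp: Im_def Ip_def)
  note le = powr_integral_le[OF prob_space_sphere_level s0 s(2)]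
  have dr: "dist_mid_spr r \<theta> A B powr r = Im + \<theta> * Ip"
    unfolding dist_mid_spr_eq_pair_norm[OF r] pair_norm_powr[OF r \<theta>0] pair_mass_def Im_def Ip_def ..
  have two: "1 \<le> 2 powr r" using r by (simp add: ge_one_powr_ge_zero)
  have coef: "1 \<le> 2 powr r * (1 + 1 / \<theta>)"
  proof -
    have "1 * 1 \<le> 2 powr r * (1 + 1 / \<theta>)" using two \<theta> by (intro mult_mono) auto
    then show ?thesis by simp
  qed
  show ?thesis
  proof (cases "d = rho s")
    case True
    have "d A B powr s = (LINT z|?\<mu>. \<bar>?h z\<bar> powr s)"
      unfolding True rho_def Lr_norm_powr[OF s(1)] by simp
    also have "\<dots> \<le> 1 + (LINT z|?\<mu>. \<bar>?h z\<bar> powr r)" by (rule le[OF ints(1) intr(1)])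
    also have "(LINT z|?\<mu>. \<bar>?h z\<bar> powr r) \<le> (LINT z|?\<mu>. split_bound r 1 1 (\<bar>?m z\<bar> powr r) (\<bar>?p z\<bar> powr r))"
    proof (rule integral_mono)
      fix z
      have "?h z = ?m z + ?p z" by (simp add: mid_eq spr_eq field_simps)
      then show "\<bar>?h z\<bar> powr r \<le> split_bound r 1 1 (\<bar>?m z\<bar> powr r) (\<bar>?p z\<bar> powr r)"
        using abs_add_powr_le_split_bound(1)[OF r, of 1 1 "?m z" "?p z"] by simp
    qed (use intr in \<open>auto simp: powr_integrable_def split_bound_def\<close>)
    also have "\<dots> = 2 powr r * ((Im + Ip) / 2)"
      using intr by (simp add: powr_integrable_def split_bound_def Im_def Ip_def field_simps)
    also have "\<dots> \<le> 2 powr r * ((1 + 1 / \<theta>) * (Im + \<theta> * Ip))"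
    proof (rule mult_left_mono)
      have "(1 + 1 / \<theta>) * (Im + \<theta> * Ip) = Im + Ip + (\<theta> * Ip + Im / \<theta>)"
        using \<theta> by (simp add: field_simps)
      moreover have "0 \<le> \<theta> * Ip + Im / \<theta>" using \<theta> Im Ip by simp
      moreover have "(Im + Ip) / 2 \<le> Im + Ip" using Im Ip by simp
      ultimately show "(Im + Ip) / 2 \<le> (1 + 1 / \<theta>) * (Im + \<theta> * Ip)" by simp
    qed simp
    finally show ?thesis unfolding dr using \<theta> by (simp add: mult.assoc)
  next
    case False
    then have "d A B powr s = pair_mass ?\<mu> s \<theta> ?m ?p"
      using d by (simp add: dist_mid_spr_eq_pair_norm[OF s(1)] pair_norm_powr[OF s(1) \<theta>0])
    also have "\<dots> \<le> (1 + Im) + \<theta> * (1 + Ip)"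
      unfolding pair_mass_def Im_def Ip_def
      using le[OF ints(2) intr(2)] le[OF ints(3) intr(3)] \<theta> by (intro add_mono mult_left_mono) auto
    also have "\<dots> = (1 + \<theta>) + 1 * (Im + \<theta> * Ip)" by (simp add: algebra_simps)
    also have "\<dots> \<le> (1 + \<theta>) + 2 powr r * (1 + 1 / \<theta>) * (Im + \<theta> * Ip)"
      using coef Im Ip \<theta> by (intro add_left_mono mult_right_mono) auto
    finally show ?thesis unfolding dr .
  qed
qed

lemma filterlim_dist_mid_spr_if_metric:
  fixes A :: "'p::finite fuzzy"
  assumes \<theta>: "0 < \<theta>" and s: "1 \<le> s" "s \<le> r" and d: "d \<in> {rho s, dist_mid_spr s \<theta>}"
    and A: "A \<in> Fc" and B: "\<And>n. B n \<in> Fc" and lim: "filterlim (\<lambda>n. d (B n) A) at_top F"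
  shows "filterlim (\<lambda>n. dist_mid_spr r \<theta> (B n) A) at_top F"
  unfolding filterlim_at_top
proof
  fix Z
  define K where "K = 2 powr r * (1 + 1 / \<theta>)"
  define Z' where "Z' = (1 + \<theta>) + K * max Z 0 powr r + 2"
  have K: "0 \<le> K" using \<theta> by (simp add: K_def)
  have "eventually (\<lambda>n. Z' \<le> d (B n) A) F" using lim by (simp add: filterlim_at_top)
  then show "eventually (\<lambda>n. Z \<le> dist_mid_spr r \<theta> (B n) A) F"
  proof eventually_elim
    case (elim n)
    show ?case
    proof (rule ccontr)
      assume "\<not> Z \<le> dist_mid_spr r \<theta> (B n) A"
      then have "dist_mid_spr r \<theta> (B n) A powr r \<le> max Z 0 powr r"
        using s dist_mid_spr_nonneg[of r \<theta> "B n" A] by (intro powr_mono2) auto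
      then have "K * dist_mid_spr r \<theta> (B n) A powr r \<le> K * max Z 0 powr r"
        using K by (rule mult_left_mono)
      then have "d (B n) A powr s \<le> (1 + \<theta>) + K * max Z 0 powr r"
        using metric_powr_le_dist_mid_spr_powr[OF \<theta> s d B[of n] A, folded K_def] by linarith
      moreover have "0 \<le> K * max Z 0 powr r" using K by simp
      then have "0 \<le> d (B n) A" using elim \<theta> unfolding Z'_def by linarith
      then have "d (B n) A - 1 \<le> d (B n) A powr s" using s(1) by (rule powr_ge_minus_one)
      ultimately show False using elim unfolding Z'_def by linarith
    qed
  qed
qed

text \<open>The cone over the open half sphere is a non-empty open part of the ball.\<close>

lemma emeasure_open_halfsphere_pos:
  fixes v :: "real ^ 'p::finite"
  assumes v: "v \<noteq> 0"
  defines "S \<equiv> {u \<in> sphere 0 1. 0 < u \<bullet> v}"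
  shows "S \<in> sets sphere_measure" and "emeasure sphere_measure S \<noteq> 0"
proof -
  let ?H = "{u. 0 < u \<bullet> v}"
  have H: "open ?H" by (intro open_Collect_less continuous_intros)
  have "S = sphere 0 1 \<inter> ?H" by (auto simp: S_def)
  then show S: "S \<in> sets sphere_measure"
    using H by (simp add: sets_sphere_measure sets_restrict_space_iff)
  let ?C = "{x \<in> ball 0 1 - {0}. sgn x \<in> S}"
  have C: "?C = ball 0 1 \<inter> ?H"
  proof (intro set_eqI)
    fix x
    show "x \<in> ?C \<longleftrightarrow> x \<in> ball 0 1 \<inter> ?H"
    proof (cases "x = 0")
      case False
      then have "0 < sgn x \<bullet> v \<longleftrightarrow> 0 < x \<bullet> v" "norm (sgn x) = 1"
        by (auto simp: sgn_div_norm zero_less_mult_iff)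
      then show ?thesis using False by (simp add: S_def)
    qed simp
  qed
  have "v /\<^sub>R (2 * norm v) \<in> ?C"
    unfolding C using v by (simp add: zero_less_mult_iff)
  then have "?C \<noteq> {}" by blast
  moreover have op: "open ?C" unfolding C using H by (intro open_Int) auto
  ultimately have "\<not> negligible ?C" using open_not_negligible by blast
  then have "?C \<notin> null_sets lebesgue" by (simp add: negligible_iff_null_sets)
  then have "?C \<notin> null_sets lborel" using null_sets_completion_iff2 by blast
  then have "emeasure lborel ?C \<noteq> 0" using op by (auto simp: null_sets_def)
  then show "emeasure sphere_measure S \<noteq> 0"
    using emeasure_sphere_measure[OF S] emeasure_unit_ball_finite[where 'p='p]
    by (simp add: ennreal_divide_eq_0_iff)
qed

text \<open>Some \<open>v \<noteq> 0\<close> has positive membership. On the open half sphere around \<open>v\<close> and for levels up to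
  \<open>U v\<close>, the support function is at least \<open>\<langle>u, v\<rangle> > 0\<close>, and this set has positive measure, while a vanishing norm would make mid and
  spread, and so their sum, the support function, vanish almost everywhere.\<close>

lemma pair_norm_supp_fun_pos:
  fixes U :: "'p::finite fuzzy"
  assumes r: "1 \<le> r" and \<theta>: "0 < \<theta>" and U: "U \<in> Fc" and ne: "U \<noteq> crisp_zero"
  shows "0 < pair_norm sphere_level_measure r \<theta> (mid (supp_fun U)) (spr (supp_fun U))"
proof (rule ccontr)
  let ?\<mu> = "sphere_level_measure :: ((real ^ 'p) \<times> real) measure"
  assume "\<not> 0 < pair_norm ?\<mu> r \<theta> (mid (supp_fun U)) (spr (supp_fun U))"
  then have zero: "pair_norm ?\<mu> r \<theta> (mid (supp_fun U)) (spr (supp_fun U)) = 0"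
    using pair_norm_nonneg less_eq_real_def by metis
  obtain v where v: "v \<noteq> 0" "0 < U v"
  proof (rule ccontr)
    assume "\<not> thesis"
    then have off: "U x = 0" if "x \<noteq> 0" for x
      using that \<open>\<And>v. v \<noteq> 0 \<Longrightarrow> 0 < U v \<Longrightarrow> thesis\<close> Fc_range(1)[OF U, of x] less_eq_real_def by auto
    obtain w where "w \<in> level U 1" using level_nonempty_compact_convex(1)[OF U, of 1] by auto
    then have w: "U w = 1" using Fc_range(2)[OF U, of w] by (simp add: level_def)
    then have "w = 0" using off[of w] by auto
    then have "U = crisp_zero" using off w by (auto simp: crisp_zero_def indicator_def)
    then show False using ne by simp
  qed
  have r0: "0 \<le> r" using r by simp
  have pz: "AE z in ?\<mu>. mid (supp_fun U) z = 0" "AE z in ?\<mu>. spr (supp_fun U) z = 0"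
  proof -
    have b: "\<bar>mid (supp_fun U) z\<bar> \<le> set_norm (level U 0)" "\<bar>spr (supp_fun U) z\<bar> \<le> set_norm (level U 0)"
      if z: "z \<in> space ?\<mu>" for z
      using abs_supp_fun_le_on_space[OF U z] abs_supp_fun_le_on_space[OF U reflect_in_space[OF z]]
      unfolding mid_eq spr_eq by (auto simp: abs_le_iff field_simps)
    have "powr_integrable ?\<mu> r (mid (supp_fun U))" "powr_integrable ?\<mu> r (spr (supp_fun U))"
      using measurable_supp_fun[OF U] b r0
      by (auto intro!: powr_integrable_bounded(1)[OF prob_space_sphere_level])
    from pair_norm_eq_0D[OF less_imp_le[OF \<theta>] this zero] \<theta>
    show "AE z in ?\<mu>. mid (supp_fun U) z = 0" "AE z in ?\<mu>. spr (supp_fun U) z = 0" by auto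
  qed
  \<comment> \<open>The support function is the sum of mid and spread.\<close>
  have s_zero: "AE z in ?\<mu>. supp_fun U z = 0"
    using pz
  proof eventually_elim
    case (elim z)
    then show ?case by (simp add: mid_eq spr_eq)
  qed
  define S where "S = {u \<in> sphere 0 1. 0 < u \<bullet> v}"
  note S = emeasure_open_halfsphere_pos[OF v(1), folded S_def]
  let ?L = "restrict_space lborel {0..1::real}" and ?R = "{0..U v}"
  have Uv: "U v \<le> 1" by (rule Fc_range(2)[OF U])
  have R: "?R \<in> sets ?L" "emeasure ?L ?R = ennreal (U v)"
    using Uv v by (auto simp: sets_restrict_space_iff emeasure_restrict_space)
  have pos: "supp_fun U z \<noteq> 0" if zS: "z \<in> S \<times> ?R" for z
  proof -
    obtain u \<alpha> where z: "z = (u, \<alpha>)" and u: "0 < u \<bullet> v" and \<alpha>: "0 \<le> \<alpha>" "\<alpha> \<le> U v"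
      using zS by (auto simp: S_def)
    have "v \<in> level U (U v)" using v by (simp add: in_level_iff)
    then have "v \<in> level U \<alpha>" using level_antimono[OF \<alpha>, of U] by auto
    then have "u \<bullet> v \<le> supp_fun U z"
      unfolding z supp_fun_eq_support using level_nonempty_compact_convex(2)[OF U, of \<alpha>] \<alpha> Uv
      by (intro inner_le_support) auto
    then show ?thesis using u by simp
  qed
  interpret L: prob_space ?L by (rule prob_space_restrict_space) auto
  have "emeasure ?\<mu> (S \<times> ?R) = emeasure sphere_measure S * emeasure ?L ?R"
    unfolding sphere_level_measure_def by (rule L.emeasure_pair_measure_Times[OF S(1) R(1)])
  also have "\<dots> \<noteq> 0" using S(2) R(2) v by (simp add: ennreal_eq_0_iff)
  finally have "emeasure ?\<mu> (S \<times> ?R) \<noteq> 0" .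
  moreover have "S \<times> ?R \<in> null_sets ?\<mu>"
  proof (rule AE_iff_null_sets[THEN iffD2])
    show "S \<times> ?R \<in> sets ?\<mu>" unfolding sphere_level_measure_def using S(1) R(1) by simp
    show "AE z in ?\<mu>. z \<notin> S \<times> ?R" using s_zero pos by (auto elim!: eventually_mono)
  qed
  ultimately show False by (auto simp: null_sets_def)
qed

lemma dist_mid_spr_add_scale:
  fixes A U :: "'p::finite fuzzy"
  assumes r: "1 \<le> r" and \<theta>: "0 \<le> \<theta>" and A: "A \<in> Fc" and U: "U \<in> Fc" and l: "0 \<le> l"
  shows "dist_mid_spr r \<theta> (fuzzy_add A (fuzzy_scale l U)) A
    = l * pair_norm sphere_level_measure r \<theta> (mid (supp_fun U)) (spr (supp_fun U))"
proof -
  let ?\<mu> = "sphere_level_measure :: ((real ^ 'p) \<times> real) measure"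
  let ?B = "fuzzy_add A (fuzzy_scale l U)"
  have B: "?B \<in> Fc" by (intro fuzzy_add_Fc fuzzy_scale_Fc A U l)
  have s: "supp_fun ?B z = supp_fun A z + l * supp_fun U z" if "z \<in> space ?\<mu>" for z
  proof -
    obtain u \<alpha> where "z = (u, \<alpha>)" "\<alpha> \<in> {0..1}" using \<open>z \<in> space ?\<mu>\<close> by (auto simp: space_sphere_level)
    then show ?thesis
      using A U l by (simp add: supp_fun_add supp_fun_scale fuzzy_scale_Fc del: atLeastAtMost_iff)
  qed
  note meas = measurable_supp_fun(2,3)
  have "dist_mid_spr r \<theta> ?B A = pair_norm ?\<mu> r \<theta> (\<lambda>z. l * mid (supp_fun U) z) (\<lambda>z. l * spr (supp_fun U) z)"
    unfolding dist_mid_spr_eq_pair_norm[OF r]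
  proof (rule pair_norm_cong_AE)
    show "AE z in ?\<mu>. mid (supp_fun ?B) z - mid (supp_fun A) z = l * mid (supp_fun U) z"
      and "AE z in ?\<mu>. spr (supp_fun ?B) z - spr (supp_fun A) z = l * spr (supp_fun U) z"
      using s s[OF reflect_in_space] by (auto intro!: AE_I2 simp: mid_eq spr_eq field_simps)
  qed (intro borel_measurable_diff borel_measurable_times borel_measurable_const meas A B U)+
  then show ?thesis unfolding pair_norm_scale[OF r \<theta>] using l by simp
qed

section \<open>Properties of the location depths\<close>

theorem theorem4p22:
  fixes M :: "'w measure"
    and r \<theta> :: real
    and H1 Hr H :: "('w \<Rightarrow> 'p::finite fuzzy) set"
    and D :: "'p fuzzy \<Rightarrow> ('w \<Rightarrow> 'p fuzzy) \<Rightarrow> real"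
    and X :: "'w \<Rightarrow> 'p fuzzy"
    and A :: "'p fuzzy"
  assumes "prob_space M"
    and "1 \<le> r" and "0 \<le> \<theta>"
    and "H1 \<subseteq> Lr_fuzzy M 1" and "Hr \<subseteq> Lr_fuzzy M r"
    and "(D, H) \<in> {(location_depth M r \<theta>, H1), (location_raised_depth M r \<theta>, Hr)}"
    and "X \<in> H" and "A \<in> Fc"
    and "D A X = (SUP B\<in>Fc. D B X)"
  shows "(\<forall>l\<in>{0..1}. \<forall>U\<in>Fc.
      D A X \<ge> D (fuzzy_add (fuzzy_scale (1 - l) A) (fuzzy_scale l U)) X \<and>
      D (fuzzy_add (fuzzy_scale (1 - l) A) (fuzzy_scale l U)) X \<ge> D U X) \<and>
    (\<theta> > 0 \<longrightarrow> (\<forall>U\<in>Fc - {crisp_zero}.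
      ((\<lambda>l. D (fuzzy_add A (fuzzy_scale l U)) X) \<longlongrightarrow> 0) at_top)) \<and>
    (\<theta> > 0 \<longrightarrow> (\<forall>s>1. \<forall>d\<in>{rho s, dist_mid_spr s \<theta>}. \<forall>U\<in>Fc. \<forall>V\<in>Fc.
      d A V = d A U + d U V \<longrightarrow> D A X \<ge> D U X \<and> D U X \<ge> D V X)) \<and>
    (\<theta> > 0 \<longrightarrow> (\<forall>s\<in>{1..r}. \<forall>d\<in>{rho s, dist_mid_spr s \<theta>}. \<forall>An :: nat \<Rightarrow> 'p fuzzy.
      (\<forall>n. An n \<in> Fc) \<longrightarrow> filterlim (\<lambda>n. d (An n) A) at_top sequentially \<longrightarrow>
      (\<lambda>n. D (An n) X) \<longlonglongrightarrow> 0))"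
proof -
  note M = assms(1) and r = assms(2) and \<theta> = assms(3) and A = assms(8)
  \<comment> \<open>The class is compared along with the depth, so that the moment of \<open>X\<close> matches the exponent.\<close>
  define e where "e = (if D = location_depth M r \<theta> \<and> H = H1 then 1 else r)"
  have e: "1 \<le> e" using r by (simp add: e_def)
  have X: "X \<in> Lr_fuzzy M e" using assms(4-7) by (auto simp: e_def)
  have D: "D B X = inverse (1 + cost M r \<theta> e X B)" for B
    using assms(6) by (auto simp: e_def location_depth_eq_cost location_raised_depth_eq_cost)
  have le_iff: "D B X \<le> D C X \<longleftrightarrow> cost M r \<theta> e X C \<le> cost M r \<theta> e X B" for B C
  proof -
    have "0 < 1 + cost M r \<theta> e X B" "0 < 1 + cost M r \<theta> e X C"
      using cost_nonneg[of M r \<theta> e X B] cost_nonneg[of M r \<theta> e X C] by linarith+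
    then show ?thesis unfolding D by simp
  qed
  \<comment> \<open>Depths are at most 1, so the supremum really bounds them and \<open>A\<close> is a maximizer.\<close>
  have bdd: "bdd_above ((\<lambda>B. D B X) ` Fc)"
  proof (rule bdd_aboveI2)
    fix B
    show "D B X \<le> 1"
      unfolding D using cost_nonneg[of M r \<theta> e X B] by (intro inverse_le_1_iff[THEN iffD2]) auto
  qed
  have max: "D B X \<le> D A X" if "B \<in> Fc" for B
    unfolding assms(9) by (rule cSUP_upper[OF that bdd])
  have between: "D B X \<le> D C X" if "B \<in> Fc" "C \<in> Fc" "0 \<le> l" "l \<le> 1" "ae_between l A B C" for B C l
    using cost_between_le[OF M r \<theta> e X A that(1,2,3,4,5)] max[OF that(1)] unfolding le_iff by blast
  have along_segments: "\<forall>l\<in>{0..1}. \<forall>U\<in>Fc.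
      D A X \<ge> D (fuzzy_add (fuzzy_scale (1 - l) A) (fuzzy_scale l U)) X \<and>
      D (fuzzy_add (fuzzy_scale (1 - l) A) (fuzzy_scale l U)) X \<ge> D U X"
  proof (intro ballI)
    fix l :: real and U :: "'p fuzzy" assume l: "l \<in> {0..1}" and U: "U \<in> Fc"
    let ?C = "fuzzy_add (fuzzy_scale (1 - l) A) (fuzzy_scale l U)"
    have C: "?C \<in> Fc" using l by (intro fuzzy_add_Fc fuzzy_scale_Fc A U) auto
    have "ae_between l A U ?C" using l by (intro ae_between_fuzzy_convex_combination A U) auto
    then show "D ?C X \<le> D A X \<and> D U X \<le> D ?C X"
      using max[OF C] between[OF U C] l by auto
  qed
  have along_rays: "\<forall>U\<in>Fc - {crisp_zero}. ((\<lambda>l. D (fuzzy_add A (fuzzy_scale l U)) X) \<longlongrightarrow> 0) at_top"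
    if \<theta>': "0 < \<theta>"
  proof
    fix U :: "'p fuzzy" assume "U \<in> Fc - {crisp_zero}"
    then have U: "U \<in> Fc" "U \<noteq> crisp_zero" by auto
    have nonneg: "eventually (\<lambda>l :: real. 0 \<le> l) at_top" by (rule eventually_ge_at_top)
    define c where "c = pair_norm sphere_level_measure r \<theta> (mid (supp_fun U)) (spr (supp_fun U))"
    have c: "0 < c" unfolding c_def by (rule pair_norm_supp_fun_pos[OF r \<theta>' U])
    have "filterlim (\<lambda>l. l * c) at_top at_top"
      by (rule filterlim_at_top_mult_tendsto_pos[OF tendsto_const c filterlim_ident])
    then have "filterlim (\<lambda>l. dist_mid_spr r \<theta> (fuzzy_add A (fuzzy_scale l U)) A) at_top at_top"
      by (rule filterlim_at_top_mono)
        (use nonneg in \<open>eventually_elim, simp add: dist_mid_spr_add_scale[OF r \<theta> A U(1)] c_def\<close>)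
    moreover have "eventually (\<lambda>l. fuzzy_add A (fuzzy_scale l U) \<in> Fc) at_top"
      by (rule eventually_mono[OF nonneg]) (intro fuzzy_add_Fc fuzzy_scale_Fc A U(1))
    ultimately show "((\<lambda>l. D (fuzzy_add A (fuzzy_scale l U)) X) \<longlongrightarrow> 0) at_top"
      unfolding D by (intro depth_tendsto_0[OF M r \<theta> e X A])
  qed
  have metric_between: "\<forall>s>1. \<forall>d\<in>{rho s, dist_mid_spr s \<theta>}. \<forall>U\<in>Fc. \<forall>V\<in>Fc.
      d A V = d A U + d U V \<longrightarrow> D A X \<ge> D U X \<and> D U X \<ge> D V X" if \<theta>': "0 < \<theta>"
  proof (intro allI impI ballI)
    fix s :: real and d and U V :: "'p fuzzy"
    assume s: "1 < s" and d: "d \<in> {rho s, dist_mid_spr s \<theta>}" and U: "U \<in> Fc" and V: "V \<in> Fc"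
      and eq: "d A V = d A U + d U V"
    obtain l where l: "0 \<le> l" "l \<le> 1" "ae_between l A V U"
      by (rule ae_between_if_metric_between[OF s \<theta>' d A U V eq])
    show "D U X \<le> D A X \<and> D V X \<le> D U X"
      using max[OF U] between[OF V U l] by simp
  qed
  have divergent: "\<forall>s\<in>{1..r}. \<forall>d\<in>{rho s, dist_mid_spr s \<theta>}. \<forall>An :: nat \<Rightarrow> 'p fuzzy.
      (\<forall>n. An n \<in> Fc) \<longrightarrow> filterlim (\<lambda>n. d (An n) A) at_top sequentially \<longrightarrow>
      (\<lambda>n. D (An n) X) \<longlonglongrightarrow> 0" if \<theta>': "0 < \<theta>"
  proof (intro allI impI ballI)
    fix s :: real and d and An :: "nat \<Rightarrow> 'p fuzzy"
    assume s: "s \<in> {1..r}" and d: "d \<in> {rho s, dist_mid_spr s \<theta>}" and An: "\<forall>n. An n \<in> Fc"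
      and lim: "filterlim (\<lambda>n. d (An n) A) at_top sequentially"
    have "filterlim (\<lambda>n. dist_mid_spr r \<theta> (An n) A) at_top sequentially"
      using s An by (intro filterlim_dist_mid_spr_if_metric[OF \<theta>' _ _ d A _ lim]) auto
    then show "(\<lambda>n. D (An n) X) \<longlonglongrightarrow> 0"
      unfolding D using An by (intro depth_tendsto_0[OF M r \<theta> e X A]) auto
  qed
  show ?thesis using along_segments along_rays metric_between divergent by blast
qed

end
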